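(* Let $A\in\mathbb{R}^{m\times n}$, $B\in\mathbb{R}^{m\times\ell}$ of full row rank, and $G\in\mathbb{R}^{d\times n}$ of full column rank, with $\ell=d\ge m\ge n$, and let $k<n$. Let $A=ZD_AW^T$, $B=ZD_BU^T$, $G=VD_GW^T$ be a restricted SVD of $(A,B,G)$ of the form given in the context, and let $Z_k,W_k,U_k,V_k$ denote the first $k$ columns of $Z,W,U,V$. Let $Q_{Z_k}\in\mathbb{R}^{m\times k}$, $Q_{W_k}\in\mathbb{R}^{n\times k}$ be the $Q$-factors of $Z_k,W_k$, and let $\widehat{T}_Z,T_{Z_{22}},\widehat{T}_W,T_{W_{22}}$ be the blocks of the triangular factors of $Z$ and $W$ defined in the context. Let $S\in\mathbb{R}^{m\times k}$, $P\in\mathbb{R}^{n\times k}$, $P_B\in\mathbb{R}^{\ell\times k}$, $S_G\in\mathbb{R}^{d\times k}$ be index selection matrices, with associated RSVD-CUR approximations $C_AM_AR_A$, $C_BM_BR_B$, $C_GM_GR_G$. Suppose $Q_{W_k}^TP$, $U_k^TP_B$, $S_G^TV_k$ and $S^TQ_{Z_k}$ are nonsingular, and put $$\eta_p=\|(Q_{W_k}^TP)^{-1}\|,\quad \eta_s=\|(S^TQ_{Z_k})^{-1}\|,\quad \eta_{p_B}=\|(U_k^TP_B)^{-1}\|,\quad \eta_{s_G}=\|(S_G^TV_k)^{-1}\|.$$ Then $$\begin{aligned} \|A-C_AM_AR_A\|&\le \alpha_{k+1}\,\bigl(\eta_p\,\|\widehat{T}_Z\|\,\| T_{W_{22}}\|+\eta_s\,\|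 T_{Z_{22}}\|\,\|\widehat{T}_W\|\bigr)\le \alpha_{k+1}\,(\eta_p+\eta_s)\,\|\widehat{T}_W\|\,\|\widehat{T}_Z\|,\\ \|B-C_BM_BR_B\|&\le \eta_{p_B}\,\|\widehat{T}_Z\|+\eta_s\,\| T_{Z_{22}}\|\le(\eta_{p_B}+\eta_s)\,\|\widehat{T}_Z\|,\\ \|G-C_GM_GR_G\|&\le \gamma_{k+1}\,\bigl(\eta_p\,\| T_{W_{22}}\|+\eta_{s_G}\,\|\widehat{T}_W\|\bigr)\le\gamma_{k+1}\,(\eta_p+\eta_{s_G})\,\|\widehat{T}_W\|. \end{aligned}$$
   Context: $\|\cdot\|$ is the spectral norm and $^+$ the pseudoinverse. **RSVD.** A restricted SVD of $(A,B,G)$ consists of orthogonal $U\in\mathbb{R}^{\ell\times\ell}$, $V\in\mathbb{R}^{d\times d}$ and nonsingular $Z\in\mathbb{R}^{m\times m}$, $W\in\mathbb{R}^{n\times n}$ with $A=ZD_AW^T$, $B=ZD_BU^T$, $G=VD_GW^T$, where $$D_A=\begin{bmatrix}\mathrm{diag}(\alpha_1,\dots,\alpha_n)\\0_{m-n,n}\end{bmatrix},\quad D_B=\begin{bmatrix}\mathrm{diag}(\beta_1,\dots,\beta_n)&0&0_{n,\ell-m}\\0&I_{m-n}&0_{m-n,\ell-m}\end{bmatrix},\quad D_G=\begin{bmatrix}\mathrm{diag}(\gamma_1,\dots,\gamma_n)\\0_{d-n,n}\end{bmatrix},$$ with $1>\alpha_i\ge\alpha_{i+1}>0$, $0<\beta_i\le\beta_{i+1}<1$,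 $1>\gamma_i\ge\gamma_{i+1}>0$. **QR factorizations.** Write $Z=[Z_k\ \widehat{Z}]$ and $W=[W_k\ \widehat{W}]$, and take QR factorizations $$Z=Q_ZT_Z=[Q_{Z_k}\ \widehat{Q}_Z]\begin{bmatrix}T_{Z_k}&T_{Z_{12}}\\0&T_{Z_{22}}\end{bmatrix},\qquad W=Q_WT_W=[Q_{W_k}\ \widehat{Q}_W]\begin{bmatrix}T_{W_k}&T_{W_{12}}\\0&T_{W_{22}}\end{bmatrix},$$ with $Q_Z,Q_W$ orthogonal and $T_Z,T_W$ upper triangular, where $T_{Z_k},T_{W_k}\in\mathbb{R}^{k\times k}$. Set $$\widehat{T}_Z=\begin{bmatrix}T_{Z_{12}}\\ T_{Z_{22}}\end{bmatrix},\qquad \widehat{T}_W=\begin{bmatrix}T_{W_{12}}\\ T_{W_{22}}\end{bmatrix}.$$ **RSVD-CUR approximation.** An index selection matrix is a matrix whose $k$ columns are distinct columns of an identity matrix. Given index selection matrices $S\in\mathbb{R}^{m\times k}$, $P\in\mathbb{R}^{n\times k}$, $P_B\in\mathbb{R}^{\ell\times k}$, $S_G\in\mathbb{R}^{d\times k}$, set $C_A=AP$, $R_A=S^TA$, $C_B=BP_B$, $R_B=S^TB$, $C_G=GP$, $R_G=S_G^TG$ (the same rows of $A$ and $B$, and the same columns of $A$ and $G$, are selected). The middle matrices are $M_A=C_A^+AR_A^+=(C_A^TC_A)^{-1}C_A^TAR_A^T(R_AR_A^T)^{-1}$ and similarly $M_B=C_B^+BR_B^+$, $M_G=C_G^+GR_G^+$.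 *)

theory Defs
  imports "Jordan_Normal_Form.DL_Rank" "Jordan_Normal_Form.Gauss_Jordan_Elimination" Complex_Main
begin

section \<open>Norms, inverses and pseudoinverses of real matrices\<close>

definition norm2_vec :: "real vec \<Rightarrow> real" where
  "norm2_vec v = sqrt (v \<bullet> v)"

text \<open>The unit ball, rather than the unit sphere, is used so that the set is nonempty even
  for a matrix without columns.\<close>

definition spectral_norm :: "real mat \<Rightarrow> real" where
  "spectral_norm A =
     (SUP v \<in> {v \<in> carrier_vec (dim_col A). norm2_vec v \<le> 1}. norm2_vec (A *\<^sub>v v))"

text \<open>Only meaningful for nonsingular \<open>A\<close>; otherwise it is an unspecified matrix.\<close>

definition inv_mat :: "real mat \<Rightarrow> real mat" where
  "inv_mat A = the (mat_inverse A)"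

definition is_pinv :: "real mat \<Rightarrow> real mat \<Rightarrow> bool" where
  "is_pinv A X \<longleftrightarrow> X \<in> carrier_mat (dim_col A) (dim_row A) \<and>
     A * X * A = A \<and> X * A * X = X \<and>
     transpose_mat (A * X) = A * X \<and> transpose_mat (X * A) = X * A"

definition pinv :: "real mat \<Rightarrow> real mat" where
  "pinv A = (THE X. is_pinv A X)"

lemma inv_mat:
  assumes A: "A \<in> carrier_mat n n" and inv: "invertible_mat A"
  shows "A * inv_mat A = 1\<^sub>m n" "inv_mat A * A = 1\<^sub>m n" "inv_mat A \<in> carrier_mat n n"
proof -
  obtain B where B: "A * B = 1\<^sub>m (dim_row A)" "B * A = 1\<^sub>m (dim_row B)"
    using inv unfolding invertible_mat_def inverts_mat_def by auto
  have "dim_row B = n" using arg_cong[OF B(2), of dim_col] A by simp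
  moreover have "dim_col B = n" using arg_cong[OF B(1), of dim_col] A by simp
  ultimately have Bc: "B \<in> carrier_mat n n" by auto
  have AB: "A * B = 1\<^sub>m n" using B(1) A by simp
  have BA: "B * A = 1\<^sub>m n" using B(2) Bc by simp
  have "A \<in> Units (ring_mat TYPE(real) n ())"
    unfolding Units_def ring_mat_simps using A Bc AB BA by blast
  then obtain C where C: "mat_inverse A = Some C"
    using mat_inverse(1)[OF A, of "()"] by (cases "mat_inverse A") auto
  from mat_inverse(2)[OF A C] C
  show "A * inv_mat A = 1\<^sub>m n" "inv_mat A * A = 1\<^sub>m n" "inv_mat A \<in> carrier_mat n n"
    unfolding inv_mat_def by auto
qed

lemma is_pinv_unique:
  assumes X: "is_pinv A X" and Y: "is_pinv A Y"
  shows "X = Y"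
proof -
  define m n where "m = dim_row A" and "n = dim_col A"
  have A: "A \<in> carrier_mat m n" and Xc: "X \<in> carrier_mat n m" and Yc: "Y \<in> carrier_mat n m"
    using X Y unfolding is_pinv_def m_def n_def by auto
  have AX: "A * X \<in> carrier_mat m m" and AY: "A * Y \<in> carrier_mat m m"
    and XA: "X * A \<in> carrier_mat n n" and YA: "Y * A \<in> carrier_mat n n" using A Xc Yc by auto
  have x: "A * X * A = A" "X * A * X = X" "transpose_mat (A * X) = A * X" "transpose_mat (X * A) = X * A"
    and y: "A * Y * A = A" "Y * A * Y = Y" "transpose_mat (A * Y) = A * Y" "transpose_mat (Y * A) = Y * A"
    using X Y unfolding is_pinv_def by auto
  have p1: "(A * Y) * (A * X) = A * X"
    using assoc_mult_mat[OF AY A Xc] y(1) by simp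
  have p2: "(A * X) * (A * Y) = A * Y"
    using assoc_mult_mat[OF AX A Yc] x(1) by simp
  have "A * X = transpose_mat ((A * Y) * (A * X))" using p1 x(3) by simp
  also have "\<dots> = (A * X) * (A * Y)" using transpose_mult[OF AY AX] x(3) y(3) by simp
  finally have eq1: "A * X = A * Y" using p2 by simp
  have q1: "(X * A) * (Y * A) = X * A"
    using assoc_mult_mat[OF Xc A YA] assoc_mult_mat[OF A Yc A] y(1) by simp
  have q2: "(Y * A) * (X * A) = Y * A"
    using assoc_mult_mat[OF Yc A XA] assoc_mult_mat[OF A Xc A] x(1) by simp
  have "X * A = transpose_mat ((X * A) * (Y * A))" using q1 x(4) by simp
  also have "\<dots> = (Y * A) * (X * A)" using transpose_mult[OF XA YA] x(4) y(4) by simp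
  finally have eq2: "X * A = Y * A" using q2 by simp
  have "X = X * A * X" using x(2) by simp
  also have "\<dots> = Y * A * X" using eq2 by simp
  also have "\<dots> = Y * (A * X)" using assoc_mult_mat[OF Yc A Xc] .
  also have "\<dots> = Y * (A * Y)" using eq1 by simp
  also have "\<dots> = Y * A * Y" using assoc_mult_mat[OF Yc A Yc] by simp
  finally show ?thesis using y(2) by simp
qed

lemma pinv_eqI: "is_pinv A X \<Longrightarrow> pinv A = X"
  unfolding pinv_def using is_pinv_unique by blast

lemma transpose_inv_mat_sym:
  assumes M: "M \<in> carrier_mat n n" and inv: "invertible_mat M" and sym: "transpose_mat M = M"
  shows "transpose_mat (inv_mat M) = inv_mat M"
proof -
  let ?K = "inv_mat M"
  note K = inv_mat[OF M inv]
  have Kt: "transpose_mat ?K \<in> carrier_mat n n" using K(3) by simp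
  have "transpose_mat ?K * M = 1\<^sub>m n"
    using transpose_mult[OF M K(3)] K(1) sym by simp
  then have "transpose_mat ?K * M * ?K = ?K" using K(3) by simp
  then show ?thesis using assoc_mult_mat[OF Kt M K(3)] K(1) Kt by simp
qed

lemma pinv_full_column_rank:
  assumes inv: "invertible_mat (transpose_mat C * C)"
  shows "pinv C = inv_mat (transpose_mat C * C) * transpose_mat C"
proof (rule pinv_eqI)
  define m n where "m = dim_row C" and "n = dim_col C"
  have C: "C \<in> carrier_mat m n" and T: "transpose_mat C \<in> carrier_mat n m"
    unfolding m_def n_def by auto
  have M: "transpose_mat C * C \<in> carrier_mat n n" using C T by auto
  let ?K = "inv_mat (transpose_mat C * C)"
  note K = inv_mat[OF M inv]
  have sym: "transpose_mat (transpose_mat C * C) = transpose_mat C * C"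
    using transpose_mult[OF T C] by simp
  note Ks = transpose_inv_mat_sym[OF M inv sym]
  let ?X = "?K * transpose_mat C"
  have X: "?X \<in> carrier_mat n m" using K T by auto
  have XC: "?X * C = 1\<^sub>m n" using assoc_mult_mat[OF K(3) T C] K(2) by simp
  have "C * ?X * C = C" using assoc_mult_mat[OF C X C] XC C by simp
  moreover have "?X * C * ?X = ?X" unfolding XC by (rule left_mult_one_mat[OF X])
  moreover have "transpose_mat (C * ?X) = C * ?X"
    using transpose_mult[OF C X] transpose_mult[OF K(3) T] Ks assoc_mult_mat[OF C K(3) T] by simp
  ultimately show "is_pinv C ?X" using X XC unfolding is_pinv_def m_def n_def by simp
qed

lemma pinv_full_row_rank:
  assumes inv: "invertible_mat (R * transpose_mat R)"
  shows "pinv R = transpose_mat R * inv_mat (R * transpose_mat R)"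
proof (rule pinv_eqI)
  define m n where "m = dim_row R" and "n = dim_col R"
  have R: "R \<in> carrier_mat m n" and T: "transpose_mat R \<in> carrier_mat n m"
    unfolding m_def n_def by auto
  have M: "R * transpose_mat R \<in> carrier_mat m m" using R T by auto
  let ?K = "inv_mat (R * transpose_mat R)"
  note K = inv_mat[OF M inv]
  have sym: "transpose_mat (R * transpose_mat R) = R * transpose_mat R"
    using transpose_mult[OF R T] by simp
  note Ks = transpose_inv_mat_sym[OF M inv sym]
  let ?X = "transpose_mat R * ?K"
  have X: "?X \<in> carrier_mat n m" using K T by auto
  have RX: "R * ?X = 1\<^sub>m m" using assoc_mult_mat[OF R T K(3)] K(1) by simp
  have "R * ?X * R = R" using RX R by simp
  moreover have "?X * R * ?X = ?X" 
    using assoc_mult_mat[OF X R X] RX right_mult_one_mat[OF X] by (metis (no_types))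
  moreover have "transpose_mat (?X * R) = ?X * R"
    using transpose_mult[OF X R] transpose_mult[OF T K(3)] Ks assoc_mult_mat[OF T K(3) R] by simp
  ultimately show "is_pinv R ?X" using X RX unfolding is_pinv_def m_def n_def by simp
qed

section \<open>Blocks of matrices\<close>

definition first_cols :: "nat \<Rightarrow> real mat \<Rightarrow> real mat" where
  "first_cols k A = mat (dim_row A) k (\<lambda>(i, j). A $$ (i, j))"

definition drop_cols :: "nat \<Rightarrow> real mat \<Rightarrow> real mat" where
  "drop_cols k A = mat (dim_row A) (dim_col A - k) (\<lambda>(i, j). A $$ (i, j + k))"

definition drop_rows :: "nat \<Rightarrow> real mat \<Rightarrow> real mat" where
  "drop_rows k A = mat (dim_row A - k) (dim_col A) (\<lambda>(i, j). A $$ (i + k, j))"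

section \<open>Restricted SVD, QR factorization and index selection\<close>

text \<open>The library's \<open>orthogonal_mat\<close> only asks for pairwise orthogonal nonzero columns,
  which is weaker than what is meant here.\<close>

definition is_orthogonal :: "nat \<Rightarrow> real mat \<Rightarrow> bool" where
  "is_orthogonal n Q \<longleftrightarrow> Q \<in> carrier_mat n n \<and>
     transpose_mat Q * Q = 1\<^sub>m n \<and> Q * transpose_mat Q = 1\<^sub>m n"

text \<open>The sequences \<open>\<alpha>\<close>, \<open>\<beta>\<close>, \<open>\<gamma>\<close> are indexed from \<open>1\<close> to \<open>n\<close>,
  whereas matrix entries are indexed from \<open>0\<close>.\<close>

definition rsvd_diag :: "nat \<Rightarrow> nat \<Rightarrow> (nat \<Rightarrow> real) \<Rightarrow> real mat" where
  "rsvd_diag r n \<alpha> = mat r n (\<lambda>(i, j). if i = j then \<alpha> (i + 1) else 0)"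

definition rsvd_DB :: "nat \<Rightarrow> nat \<Rightarrow> nat \<Rightarrow> (nat \<Rightarrow> real) \<Rightarrow> real mat" where
  "rsvd_DB m n l \<beta> =
     mat m l (\<lambda>(i, j). if i = j then (if i < n then \<beta> (i + 1) else 1) else 0)"

definition is_RSVD ::
  "nat \<Rightarrow> nat \<Rightarrow> nat \<Rightarrow> nat \<Rightarrow> real mat \<Rightarrow> real mat \<Rightarrow> real mat \<Rightarrow>
   real mat \<Rightarrow> real mat \<Rightarrow> real mat \<Rightarrow> real mat \<Rightarrow>
   (nat \<Rightarrow> real) \<Rightarrow> (nat \<Rightarrow> real) \<Rightarrow> (nat \<Rightarrow> real) \<Rightarrow> bool" where
  "is_RSVD m n l d A B G U V Z W \<alpha> \<beta> \<gamma> \<longleftrightarrow>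
     is_orthogonal l U \<and> is_orthogonal d V \<and>
     Z \<in> carrier_mat m m \<and> invertible_mat Z \<and> W \<in> carrier_mat n n \<and> invertible_mat W \<and>
     A = Z * rsvd_diag m n \<alpha> * transpose_mat W \<and>
     B = Z * rsvd_DB m n l \<beta> * transpose_mat U \<and>
     G = V * rsvd_diag d n \<gamma> * transpose_mat W \<and>
     (\<forall>i\<in>{1..n}. 0 < \<alpha> i \<and> \<alpha> i < 1 \<and> 0 < \<beta> i \<and> \<beta> i < 1 \<and> 0 < \<gamma> i \<and> \<gamma> i < 1) \<and>
     (\<forall>i\<in>{1..<n}. \<alpha> (i + 1) \<le> \<alpha> i \<and> \<beta> i \<le> \<beta> (i + 1) \<and> \<gamma> (i + 1) \<le> \<gamma> i)"

definition is_QR :: "nat \<Rightarrow> real mat \<Rightarrow> real mat \<Rightarrow> real mat \<Rightarrow> bool" where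
  "is_QR n X Q T \<longleftrightarrow> is_orthogonal n Q \<and> T \<in> carrier_mat n n \<and> upper_triangular T \<and> X = Q * T"

definition is_index_selection :: "nat \<Rightarrow> nat \<Rightarrow> real mat \<Rightarrow> bool" where
  "is_index_selection r k S \<longleftrightarrow> S \<in> carrier_mat r k \<and>
     distinct (cols S) \<and> set (cols S) \<subseteq> set (cols (1\<^sub>m r))"

text \<open>The approximation \<open>C M R\<close> with \<open>C = X P\<close>, \<open>R = S\<^sup>T X\<close> and \<open>M = C\<^sup>+ X R\<^sup>+\<close>.\<close>

definition CUR_middle :: "real mat \<Rightarrow> real mat \<Rightarrow> real mat \<Rightarrow> real mat" where
  "CUR_middle X C R = pinv C * X * pinv R"

definition CUR_approx :: "real mat \<Rightarrow> real mat \<Rightarrow> real mat \<Rightarrow> real mat" where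
  "CUR_approx X P S =
     (let C = X * P; R = transpose_mat S * X in C * CUR_middle X C R * R)"

end

theory Submission
  imports Defs "HOL-Analysis.L2_Norm"
begin

text \<open>
  The three bounds are instances of one estimate. Let \<open>X = L D N\<^sup>T\<close> with \<open>L\<close> and \<open>N\<close> nonsingular,
  \<open>L = Q\<^sub>L T\<^sub>L\<close> and \<open>N = Q\<^sub>N T\<^sub>N\<close> their QR factorizations, and \<open>D\<close> rectangular diagonal. The
  factors \<open>(L, N)\<close> are \<open>(Z, W)\<close> for \<open>A\<close>, \<open>(Z, U)\<close> for \<open>B\<close> and \<open>(V, W)\<close> for \<open>G\<close>; an orthogonal
  factor \<open>U\<close> or \<open>V\<close> has the trivial QR factorization with triangular factor \<open>1\<close>, whose
  trailing blocks have norm at most \<open>1\<close> and hence disappear from the bounds for \<open>B\<close> and \<open>G\<close>.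

  With \<open>C = X P\<close> and \<open>R = S\<^sup>T X\<close> the approximation is \<open>E X F\<close>, where \<open>E = C C\<^sup>+\<close> and \<open>F = R\<^sup>+ R\<close> are
  orthogonal projectors, so
  \<open>X - E X F = (X - E X) + E (X - X F)\<close>
  and, as \<open>\<parallel>E\<parallel> \<le> 1\<close>, the two one-sided errors can be bounded separately. The second becomes an
  instance of the first by passing to \<open>X\<^sup>T = N D\<^sup>T L\<^sup>T\<close>.

  For the first, let \<open>Q\<close> consist of the first \<open>k\<close> columns of \<open>Q\<^sub>N\<close>, and let \<open>H = P (Q\<^sup>T P)\<^sup>-\<^sup>1 Q\<^sup>T\<close>
  be the oblique projector onto the range of \<open>P\<close> along the kernel of \<open>Q\<^sup>T\<close>. Since \<open>E\<close> fixes \<open>X P\<close> and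
  \<open>Q\<^sup>T H = Q\<^sup>T\<close>,
  \<open>X - E X = (1 - E) (X - X Q Q\<^sup>T) (1 - H)\<close>.
  The norm of \<open>1 - H\<close> is at most \<open>\<parallel>H\<parallel> \<le> \<parallel>(Q\<^sup>T P)\<^sup>-\<^sup>1\<parallel>\<close>
  (\<open>spectral_norm_complement_idempotent\<close>), which gives \<open>oblique_projection_error\<close>. Finally
  \<open>X - X Q Q\<^sup>T\<close> involves only the trailing part of the factorization: \<open>T\<^sub>N\<^sup>T\<close> is lower triangular and
  \<open>D\<close> diagonal, so the first \<open>k\<close> rows of \<open>D\<close> times the last columns of \<open>T\<^sub>N\<^sup>T\<close> vanish, and only the
  last columns of \<open>L\<close>, the diagonal entries after the \<open>k\<close>-th, and the lower right block of \<open>T\<^sub>N\<close>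
  contribute (\<open>trailing_part_norm\<close>).

  The pseudoinverses have their Gram matrix form because \<open>C\<close> and \<open>R\<^sup>T\<close> have full column rank:
  the first \<open>k\<close> diagonal entries of \<open>D\<close> are nonzero and the leading block of \<open>N\<^sup>T P\<close> is
  the product of a nonsingular triangular matrix with \<open>Q\<^sup>T P\<close>
  (\<open>selected_columns_injective\<close>).
\<close>

section \<open>The spectral norm\<close>

(* The conclusion of this rewrite rule does not determine its inner dimension, so proving its
   premises may diverge; the variant below only compares dimensions. *)
declare mult_mat_vec_carrier [simp del]

lemma mult_mat_vec_carrier_dim [simp]: "dim_row A = n \<Longrightarrow> A *\<^sub>v v \<in> carrier_vec n"
  by (rule carrier_vecI) simp

lemma norm2_vec_L2_set: "norm2_vec v = L2_set (($) v) {0..<dim_vec v}"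
  unfolding norm2_vec_def L2_set_def scalar_prod_def by (simp add: power2_eq_square)

lemma norm2_vec_nonneg: "0 \<le> norm2_vec v"
  by (simp add: norm2_vec_L2_set)

lemma norm2_vec_sq: "(norm2_vec v)\<^sup>2 = v \<bullet> v"
  unfolding norm2_vec_def by (simp add: scalar_prod_def sum_nonneg)

lemma norm2_vec_zero [simp]: "norm2_vec (0\<^sub>v n) = 0"
  by (simp add: norm2_vec_L2_set L2_set_def)

lemma norm2_vec_eq_0_iff: "norm2_vec v = 0 \<longleftrightarrow> v = 0\<^sub>v (dim_vec v)"
proof -
  have "norm2_vec v = 0 \<longleftrightarrow> (\<forall>i<dim_vec v. v $ i = 0)"
    by (auto simp: norm2_vec_L2_set L2_set_eq_0_iff)
  then show ?thesis by (auto simp: vec_eq_iff)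
qed

lemma norm2_vec_smult: "norm2_vec (c \<cdot>\<^sub>v v) = \<bar>c\<bar> * norm2_vec v"
proof -
  have "norm2_vec (c \<cdot>\<^sub>v v) = sqrt (c\<^sup>2 * (v \<bullet> v))"
    unfolding norm2_vec_def by (simp add: power2_eq_square)
  then show ?thesis unfolding norm2_vec_def by (simp add: real_sqrt_mult)
qed

lemma norm2_vec_triangle:
  assumes "dim_vec u = dim_vec v"
  shows "norm2_vec (u + v) \<le> norm2_vec u + norm2_vec v"
proof -
  have "norm2_vec (u + v) = L2_set (\<lambda>i. u $ i + v $ i) {0..<dim_vec v}"
    unfolding norm2_vec_L2_set by (rule L2_set_cong) auto
  also have "\<dots> \<le> norm2_vec u + norm2_vec v"
    unfolding norm2_vec_L2_set assms by (rule L2_set_triangle_ineq)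
  finally show ?thesis .
qed

lemma scalar_prod_le_norm2_vec:
  assumes "dim_vec u = dim_vec v"
  shows "\<bar>u \<bullet> v\<bar> \<le> norm2_vec u * norm2_vec v"
proof -
  have "\<bar>u \<bullet> v\<bar> \<le> (\<Sum>i\<in>{0..<dim_vec v}. \<bar>u $ i\<bar> * \<bar>v $ i\<bar>)"
    unfolding scalar_prod_def by (rule order_trans[OF sum_abs]) (simp add: abs_mult)
  also have "\<dots> \<le> norm2_vec u * norm2_vec v"
    unfolding norm2_vec_L2_set assms by (rule L2_set_mult_ineq)
  finally show ?thesis .
qed

text \<open>A crude Frobenius bound. It makes the supremum in the definition of the spectral norm
  one over a bounded set, without which that supremum carries no information.\<close>
lemma norm2_vec_mult_bounded:
  "norm2_vec (A *\<^sub>v v) \<le> L2_set (\<lambda>i. norm2_vec (row A i)) {0..<dim_row A} * norm2_vec v"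
  if v: "v \<in> carrier_vec (dim_col A)"
proof -
  have "norm2_vec (A *\<^sub>v v) = L2_set (\<lambda>i. \<bar>row A i \<bullet> v\<bar>) {0..<dim_row A}"
    unfolding norm2_vec_L2_set by (auto simp: L2_set_def intro!: sum.cong)
  also have "\<dots> \<le> L2_set (\<lambda>i. norm2_vec (row A i) * norm2_vec v) {0..<dim_row A}"
    by (rule L2_set_mono) (use v in \<open>auto intro!: scalar_prod_le_norm2_vec\<close>)
  also have "\<dots> = L2_set (\<lambda>i. norm2_vec (row A i)) {0..<dim_row A} * norm2_vec v"
    by (simp add: L2_set_left_distrib norm2_vec_nonneg)
  finally show ?thesis .
qed

lemma spectral_norm_bdd:
  "bdd_above ((\<lambda>v. norm2_vec (A *\<^sub>v v)) ` {v \<in> carrier_vec (dim_col A). norm2_vec v \<le> 1})"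
proof (rule bdd_aboveI2)
  fix v assume v: "v \<in> {v \<in> carrier_vec (dim_col A). norm2_vec v \<le> 1}"
  let ?c = "L2_set (\<lambda>i. norm2_vec (row A i)) {0..<dim_row A}"
  have "norm2_vec (A *\<^sub>v v) \<le> ?c * norm2_vec v"
    using v by (intro norm2_vec_mult_bounded) auto
  also have "\<dots> \<le> ?c" using v by (simp add: mult_left_le)
  finally show "norm2_vec (A *\<^sub>v v) \<le> ?c" .
qed

lemma spectral_norm_nonneg: "0 \<le> spectral_norm A"
proof -
  have "norm2_vec (A *\<^sub>v 0\<^sub>v (dim_col A)) \<le> spectral_norm A"
    unfolding spectral_norm_def by (rule cSUP_upper[OF _ spectral_norm_bdd]) simp
  then show ?thesis using norm2_vec_nonneg order_trans by blast
qed

lemma norm2_vec_mult_le: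
  assumes v: "v \<in> carrier_vec (dim_col A)"
  shows "norm2_vec (A *\<^sub>v v) \<le> spectral_norm A * norm2_vec v"
proof (cases "norm2_vec v = 0")
  case True
  then show ?thesis using norm2_vec_mult_bounded[OF v] by simp
next
  case False
  then have pos: "norm2_vec v > 0" using norm2_vec_nonneg[of v] by simp
  let ?w = "(1 / norm2_vec v) \<cdot>\<^sub>v v"
  have "norm2_vec (A *\<^sub>v ?w) \<le> spectral_norm A"
    unfolding spectral_norm_def
    by (rule cSUP_upper[OF _ spectral_norm_bdd]) (use v pos in \<open>auto simp: norm2_vec_smult\<close>)
  moreover have "A *\<^sub>v ?w = (1 / norm2_vec v) \<cdot>\<^sub>v (A *\<^sub>v v)"
    using v by (intro mult_mat_vec) auto
  ultimately show ?thesis using pos by (simp add: norm2_vec_smult field_simps)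
qed

lemma spectral_norm_leI:
  assumes "0 \<le> c" and "\<And>v. v \<in> carrier_vec (dim_col A) \<Longrightarrow> norm2_vec (A *\<^sub>v v) \<le> c * norm2_vec v"
  shows "spectral_norm A \<le> c"
  unfolding spectral_norm_def
proof (rule cSUP_least)
  show "{v \<in> carrier_vec (dim_col A). norm2_vec v \<le> 1} \<noteq> {}"
    using norm2_vec_zero[of "dim_col A"] by (metis (mono_tags, lifting) empty_Collect_eq zero_carrier_vec zero_le_one)
next
  fix v assume v: "v \<in> {v \<in> carrier_vec (dim_col A). norm2_vec v \<le> 1}"
  then have "norm2_vec (A *\<^sub>v v) \<le> c * norm2_vec v" using assms(2) by blast
  also have "\<dots> \<le> c" using v assms(1) by (simp add: mult_left_le)
  finally show "norm2_vec (A *\<^sub>v v) \<le> c" .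
qed

text \<open>Stated with carrier sets, these laws mention an inner dimension that the rewritten term does not
  determine. With equations between dimensions as side conditions they become rewrite rules that
  normalize matrix expressions.\<close>
lemma mult_assoc_dim:
  "dim_col A = dim_row B \<Longrightarrow> dim_col B = dim_row C \<Longrightarrow> (A * B) * C = A * (B * (C :: real mat))"
  by (rule assoc_mult_mat[of A "dim_row A" "dim_col A" B "dim_col B" C "dim_col C"]) auto

lemma mult_vec_assoc_dim:
  "dim_col A = dim_row B \<Longrightarrow> dim_col B = dim_vec v \<Longrightarrow> (A * B) *\<^sub>v v = A *\<^sub>v (B *\<^sub>v (v :: real vec))"
  by (rule assoc_mult_mat_vec[of A "dim_row A" "dim_col A" B "dim_col B" v]) auto

lemma transpose_mult_dim:
  "dim_col A = dim_row B \<Longrightarrow> transpose_mat (A * (B :: real mat)) = transpose_mat B * transpose_mat A"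
  by (rule transpose_mult[of A "dim_row A" "dim_col A" B "dim_col B"]) auto

lemma transpose_minus_dim:
  "dim_row A = dim_row B \<Longrightarrow> dim_col A = dim_col B \<Longrightarrow>
   transpose_mat (A - (B :: real mat)) = transpose_mat A - transpose_mat B"
  by (rule transpose_minus[of A "dim_row A" "dim_col A" B]) auto

lemma minus_mult_dim:
  "dim_row A = dim_row B \<Longrightarrow> dim_col A = dim_col B \<Longrightarrow> dim_col B = dim_row C \<Longrightarrow>
   (A - B) * (C :: real mat) = A * C - B * C"
  by (rule minus_mult_distrib_mat[of A "dim_row A" "dim_col A" B C "dim_col C"]) auto

lemma mult_minus_dim:
  "dim_row B = dim_row C \<Longrightarrow> dim_col B = dim_col C \<Longrightarrow> dim_col A = dim_row B \<Longrightarrow>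
   A * (B - (C :: real mat)) = A * B - A * C"
  by (rule mult_minus_distrib_mat[of A "dim_row A" "dim_col A" B "dim_col B" C]) auto

lemmas mat_dim_simps = mult_assoc_dim mult_vec_assoc_dim transpose_mult_dim transpose_minus_dim
  minus_mult_dim mult_minus_dim

lemma spectral_norm_mult:
  assumes "dim_col A = dim_row B"
  shows "spectral_norm (A * B) \<le> spectral_norm A * spectral_norm B"
proof (rule spectral_norm_leI)
  show "0 \<le> spectral_norm A * spectral_norm B" by (simp add: spectral_norm_nonneg)
  fix v :: "real vec" assume v: "v \<in> carrier_vec (dim_col (A * B))"
  have "norm2_vec (A * B *\<^sub>v v) = norm2_vec (A *\<^sub>v (B *\<^sub>v v))"
    using v assms by (simp add: mult_vec_assoc_dim)
  also have "\<dots> \<le> spectral_norm A * norm2_vec (B *\<^sub>v v)"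
    by (rule norm2_vec_mult_le) (simp add: assms)
  also have "\<dots> \<le> spectral_norm A * (spectral_norm B * norm2_vec v)"
    by (rule mult_left_mono) (use v in \<open>auto simp: spectral_norm_nonneg intro: norm2_vec_mult_le\<close>)
  finally show "norm2_vec (A * B *\<^sub>v v) \<le> spectral_norm A * spectral_norm B * norm2_vec v" by simp
qed

lemma spectral_norm_mult_le:
  assumes "dim_col A = dim_row B" "spectral_norm A \<le> a" "spectral_norm B \<le> b"
  shows "spectral_norm (A * B) \<le> a * b"
proof -
  have "0 \<le> a" using assms(2) spectral_norm_nonneg order_trans by blast
  then show ?thesis
    using spectral_norm_mult[OF assms(1)] mult_mono[OF assms(2,3)] spectral_norm_nonneg[of B] by linarith
qed

lemma spectral_norm_triangle:
  assumes "dim_row A = dim_row B" "dim_col A = dim_col B"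
  shows "spectral_norm (A + B) \<le> spectral_norm A + spectral_norm B"
proof (rule spectral_norm_leI)
  show "0 \<le> spectral_norm A + spectral_norm B" by (simp add: spectral_norm_nonneg)
  fix v :: "real vec" assume v: "v \<in> carrier_vec (dim_col (A + B))"
  have "(A + B) *\<^sub>v v = A *\<^sub>v v + B *\<^sub>v v"
    using v assms by (intro add_mult_distrib_mat_vec) auto
  then have "norm2_vec ((A + B) *\<^sub>v v) \<le> norm2_vec (A *\<^sub>v v) + norm2_vec (B *\<^sub>v v)"
    using assms by (simp add: norm2_vec_triangle)
  also have "\<dots> \<le> spectral_norm A * norm2_vec v + spectral_norm B * norm2_vec v"
    by (rule add_mono) (use v assms in \<open>auto intro: norm2_vec_mult_le\<close>)
  finally show "norm2_vec ((A + B) *\<^sub>v v) \<le> (spectral_norm A + spectral_norm B) * norm2_vec v"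
    by (simp add: distrib_right)
qed

lemma norm2_vec_mult_sq:
  assumes v: "v \<in> carrier_vec (dim_col A)"
  shows "(norm2_vec (A *\<^sub>v v))\<^sup>2 = v \<bullet> (transpose_mat A *\<^sub>v (A *\<^sub>v v))"
proof -
  have A: "A \<in> carrier_mat (dim_row A) (dim_col A)" by auto
  have At: "transpose_mat A \<in> carrier_mat (dim_col A) (dim_row A)" by auto
  have Av: "A *\<^sub>v v \<in> carrier_vec (dim_row A)" by (rule mult_mat_vec_carrier[OF A v])
  have "(transpose_mat A *\<^sub>v (A *\<^sub>v v)) \<bullet> v = (A *\<^sub>v v) \<bullet> (A *\<^sub>v v)"
    by (rule transpose_vec_mult_scalar[OF A v Av])
  moreover have "(transpose_mat A *\<^sub>v (A *\<^sub>v v)) \<bullet> v = v \<bullet> (transpose_mat A *\<^sub>v (A *\<^sub>v v))"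
    by (rule comm_scalar_prod[OF mult_mat_vec_carrier[OF At Av] v])
  ultimately show ?thesis by (simp add: norm2_vec_sq)
qed

text \<open>Cauchy--Schwarz applied to \<open>\<parallel>A v\<parallel>\<^sup>2 = v \<bullet> A\<^sup>T A v\<close> trades a bound on \<open>A\<^sup>T\<close> at the single vector \<open>A v\<close>
  for a bound on \<open>A\<close>. It yields both the invariance of the norm under transposition and the
  contractivity of orthogonal projectors.\<close>
lemma norm2_vec_mult_le_of_sq:
  assumes v: "v \<in> carrier_vec (dim_col A)"
    and "norm2_vec (transpose_mat A *\<^sub>v (A *\<^sub>v v)) \<le> c * norm2_vec (A *\<^sub>v v)" and "0 \<le> c"
  shows "norm2_vec (A *\<^sub>v v) \<le> c * norm2_vec v"
proof (cases "norm2_vec (A *\<^sub>v v) = 0")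
  case True
  then show ?thesis using assms(3) norm2_vec_nonneg[of v] by simp
next
  case False
  then have pos: "norm2_vec (A *\<^sub>v v) > 0" using norm2_vec_nonneg[of "A *\<^sub>v v"] by simp
  have "(norm2_vec (A *\<^sub>v v))\<^sup>2 \<le> norm2_vec v * norm2_vec (transpose_mat A *\<^sub>v (A *\<^sub>v v))"
    unfolding norm2_vec_mult_sq[OF v]
    by (rule order_trans[OF abs_ge_self scalar_prod_le_norm2_vec]) (use v in auto)
  also have "\<dots> \<le> norm2_vec v * (c * norm2_vec (A *\<^sub>v v))"
    by (rule mult_left_mono[OF assms(2) norm2_vec_nonneg])
  finally have "norm2_vec (A *\<^sub>v v) * norm2_vec (A *\<^sub>v v) \<le> (c * norm2_vec v) * norm2_vec (A *\<^sub>v v)"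
    by (simp add: power2_eq_square mult_ac)
  then show ?thesis using pos by simp
qed

lemma spectral_norm_transpose: "spectral_norm (transpose_mat A) = spectral_norm A"
proof -
  have le: "spectral_norm A \<le> spectral_norm (transpose_mat A)" for A
  proof (rule spectral_norm_leI[OF spectral_norm_nonneg])
    fix v :: "real vec" assume v: "v \<in> carrier_vec (dim_col A)"
    show "norm2_vec (A *\<^sub>v v) \<le> spectral_norm (transpose_mat A) * norm2_vec v"
      by (rule norm2_vec_mult_le_of_sq[OF v norm2_vec_mult_le spectral_norm_nonneg])
        simp
  qed
  show ?thesis using le[of A] le[of "transpose_mat A"] by simp
qed

lemma spectral_norm_orthonormal_cols:
  assumes Q: "transpose_mat Q * Q = 1\<^sub>m (dim_col Q)"
  shows "spectral_norm Q \<le> 1"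
proof (rule spectral_norm_leI)
  fix v :: "real vec" assume v: "v \<in> carrier_vec (dim_col Q)"
  have "transpose_mat Q *\<^sub>v (Q *\<^sub>v v) = v"
    using v Q mult_vec_assoc_dim[of "transpose_mat Q" Q v] by simp
  then have "(norm2_vec (Q *\<^sub>v v))\<^sup>2 = (norm2_vec v)\<^sup>2"
    unfolding norm2_vec_mult_sq[OF v] by (simp add: norm2_vec_sq)
  then show "norm2_vec (Q *\<^sub>v v) \<le> 1 * norm2_vec v"
    by (simp add: norm2_vec_nonneg)
qed simp

lemma idempotent_mult_vec:
  fixes H :: "real mat"
  assumes idem: "H * H = H" and "dim_row H = dim_vec v" "dim_col H = dim_vec v"
  shows "H *\<^sub>v (H *\<^sub>v v) = H *\<^sub>v v"
proof -
  have "(H * H) *\<^sub>v v = H *\<^sub>v (H *\<^sub>v v)" by (rule mult_vec_assoc_dim) (simp_all add: assms(2,3))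
  then show ?thesis unfolding idem ..
qed

lemma spectral_norm_projector:
  assumes "transpose_mat E = E" "E * E = E"
  shows "spectral_norm E \<le> 1"
proof (rule spectral_norm_leI)
  have sq: "dim_row E = dim_col E" using assms(1) index_transpose_mat(2)[of E] by simp
  fix v :: "real vec" assume v: "v \<in> carrier_vec (dim_col E)"
  have "E *\<^sub>v (E *\<^sub>v v) = E *\<^sub>v v"
    using sq v by (intro idempotent_mult_vec assms(2)) auto
  then show "norm2_vec (E *\<^sub>v v) \<le> 1 * norm2_vec v"
    by (intro norm2_vec_mult_le_of_sq[OF v]) (simp_all add: assms(1))
qed simp

lemma spectral_norm_diagonal:
  assumes D: "diagonal_mat D" and "0 \<le> \<delta>"
    and le: "\<And>i. i < dim_row D \<Longrightarrow> i < dim_col D \<Longrightarrow> \<bar>D $$ (i, i)\<bar> \<le> \<delta>"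
  shows "spectral_norm D \<le> \<delta>"
proof (rule spectral_norm_leI[OF \<open>0 \<le> \<delta>\<close>])
  fix v :: "real vec" assume v: "v \<in> carrier_vec (dim_col D)"
  (* the entries of v, continued by 0: D may have more rows than columns *)
  define g where "g i = (if i < dim_col D then v $ i else 0)" for i
  have entry: "\<bar>(D *\<^sub>v v) $ i\<bar> \<le> \<delta> * \<bar>g i\<bar>" if i: "i < dim_row D" for i
  proof -
    have "(D *\<^sub>v v) $ i = (\<Sum>j\<in>{0..<dim_col D}. D $$ (i, j) * v $ j)"
      using i v by (simp add: scalar_prod_def)
    also have "\<dots> = (\<Sum>j\<in>{0..<dim_col D}. if j = i then D $$ (i, i) * v $ i else 0)"
      using D i by (intro sum.cong) (auto simp: diagonal_mat_def)
    also have "\<dots> = (if i < dim_col D then D $$ (i, i) * v $ i else 0)" by simp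
    finally show ?thesis using le[OF i] unfolding g_def by (auto simp: abs_mult intro: mult_right_mono)
  qed
  have "norm2_vec (D *\<^sub>v v) = L2_set (\<lambda>i. \<bar>(D *\<^sub>v v) $ i\<bar>) {0..<dim_row D}"
    unfolding norm2_vec_L2_set by (simp add: L2_set_def)
  also have "\<dots> \<le> L2_set (\<lambda>i. \<delta> * \<bar>g i\<bar>) {0..<dim_row D}"
    using entry by (intro L2_set_mono) auto
  also have "\<dots> = \<delta> * L2_set g {0..<dim_row D}"
    by (simp add: L2_set_right_distrib[OF \<open>0 \<le> \<delta>\<close>, symmetric] L2_set_def)
  also have "\<dots> \<le> \<delta> * norm2_vec v"
  proof (rule mult_left_mono[OF _ \<open>0 \<le> \<delta>\<close>])
    have "(\<Sum>i\<in>{0..<dim_row D}. (g i)\<^sup>2) \<le> (\<Sum>i\<in>{0..<dim_row D} \<union> {0..<dim_col D}. (g i)\<^sup>2)"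
      by (rule sum_mono2) auto
    also have "\<dots> = (\<Sum>i\<in>{0..<dim_col D}. (g i)\<^sup>2)"
      by (rule sum.mono_neutral_right) (auto simp: g_def)
    also have "\<dots> = (\<Sum>i\<in>{0..<dim_col D}. (v $ i)\<^sup>2)" by (rule sum.cong) (auto simp: g_def)
    finally show "L2_set g {0..<dim_row D} \<le> norm2_vec v"
      using v by (simp add: norm2_vec_L2_set L2_set_def)
  qed
  finally show "norm2_vec (D *\<^sub>v v) \<le> \<delta> * norm2_vec v" .
qed

text \<open>An idempotent \<open>H\<close> other than \<open>0\<close> and \<open>1\<close> and its complement \<open>1 - H\<close> have the same norm; this
  is one half of that fact.
  Write \<open>x = u + v\<close> with \<open>u = H x\<close>. Exchanging the lengths of \<open>u\<close> and \<open>v\<close> gives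
  \<open>w = (\<parallel>v\<parallel> / \<parallel>u\<parallel>) u + (\<parallel>u\<parallel> / \<parallel>v\<parallel>) v\<close>, which is as long as \<open>x\<close> because the inner product of the two
  summands is unchanged, while \<open>H w\<close> has length \<open>\<parallel>v\<parallel>\<close>. Hence \<open>\<parallel>v\<parallel> \<le> \<parallel>H\<parallel> \<parallel>x\<parallel>\<close>.\<close>
lemma spectral_norm_complement_idempotent:
  assumes H: "H \<in> carrier_mat n n" and idem: "H * H = H" and nz: "H \<noteq> 0\<^sub>m n n"
  shows "spectral_norm (1\<^sub>m n - H) \<le> spectral_norm H"
proof (rule spectral_norm_leI[OF spectral_norm_nonneg])
  have dH[simp]: "dim_row H = n" "dim_col H = n" using H by auto
  fix x :: "real vec" assume "x \<in> carrier_vec (dim_col (1\<^sub>m n - H))"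
  then have x: "x \<in> carrier_vec n" by simp
  define u where "u = H *\<^sub>v x"
  define v where "v = x - u"
  have u: "u \<in> carrier_vec n" unfolding u_def by simp
  have v: "v \<in> carrier_vec n" unfolding v_def using x u by simp
  have split: "x = u + v" unfolding v_def using x u by (intro eq_vecI) auto
  have Pu: "H *\<^sub>v u = u"
    unfolding u_def using x by (intro idempotent_mult_vec idem) auto
  have Pv: "H *\<^sub>v v = 0\<^sub>v n"
    unfolding v_def mult_minus_distrib_mat_vec[OF H x u] Pu using u by (simp add: u_def[symmetric])
  have vx: "(1\<^sub>m n - H) *\<^sub>v x = v"
    unfolding v_def u_def minus_mult_distrib_mat_vec[OF one_carrier_mat H x] using x by simp
  let ?a = "norm2_vec u" and ?b = "norm2_vec v"
  have "?b \<le> spectral_norm H * norm2_vec x"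
  proof (cases "?a = 0 \<or> ?b = 0")
    case True
    then consider "?b = 0" | "?a = 0" by blast
    then show ?thesis
    proof cases
      case 1
      then show ?thesis by (simp add: spectral_norm_nonneg norm2_vec_nonneg)
    next
      (* Here x lies in the kernel of H, and the claim reduces to \<parallel>H\<parallel> \<ge> 1: H acts as the identity
         on its range, which is nontrivial. *)
      case 2
      then have "x = v" using split u v norm2_vec_eq_0_iff[of u] by simp
      moreover have "1 \<le> spectral_norm H"
      proof (rule ccontr)
        assume "\<not> 1 \<le> spectral_norm H"
        have "H *\<^sub>v y = 0\<^sub>v n" if y: "y \<in> carrier_vec n" for y :: "real vec"
        proof -
          have "H *\<^sub>v (H *\<^sub>v y) = H *\<^sub>v y"
            using y by (intro idempotent_mult_vec idem) auto
          then have "norm2_vec (H *\<^sub>v y) \<le> spectral_norm H * norm2_vec (H *\<^sub>v y)"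
            using norm2_vec_mult_le[of "H *\<^sub>v y" H] by simp
          then have "norm2_vec (H *\<^sub>v y) = 0"
            using \<open>\<not> 1 \<le> spectral_norm H\<close> norm2_vec_nonneg[of "H *\<^sub>v y"]
            by (smt (verit) mult_le_cancel_right1)
          then show ?thesis using norm2_vec_eq_0_iff[of "H *\<^sub>v y"] by simp
        qed
        then have z: "H *\<^sub>v unit_vec n j = 0\<^sub>v n" if "j < n" for j by simp
        have "H = 0\<^sub>m n n"
        proof (rule eq_matI)
          fix i j assume "i < dim_row (0\<^sub>m n n :: real mat)" "j < dim_col (0\<^sub>m n n :: real mat)"
          then have ij: "i < n" "j < n" by auto
          have "(H *\<^sub>v unit_vec n j) $ i = H $$ (i, j)"
            using ij by simp
          then show "H $$ (i, j) = (0\<^sub>m n n :: real mat) $$ (i, j)" using z ij by simp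
        qed auto
        with nz show False by simp
      qed
      ultimately show ?thesis using norm2_vec_nonneg[of v] by (simp add: mult_le_cancel_right1)
    qed
  next
    case False
    then have pos: "?a > 0" "?b > 0"
      using norm2_vec_nonneg[of u] norm2_vec_nonneg[of v] by auto
    define s where "s = ?b / ?a"
    have s: "s > 0" and sa: "s * ?a = ?b" and sb: "?b / s = ?a" unfolding s_def using pos by auto
    define w where "w = s \<cdot>\<^sub>v u + (1 / s) \<cdot>\<^sub>v v"
    have w: "w \<in> carrier_vec n" unfolding w_def using u v by simp
    have uv: "v \<bullet> u = u \<bullet> v" by (rule comm_scalar_prod[OF v u])
    have "w \<bullet> w = s\<^sup>2 * (u \<bullet> u) + 2 * (u \<bullet> v) + (1 / s)\<^sup>2 * (v \<bullet> v)"
      unfolding w_def using u v s uv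
      by (simp add: add_scalar_prod_distrib[of _ n] scalar_prod_add_distrib[of _ n]
          power2_eq_square field_simps)
    also have "\<dots> = (s * ?a)\<^sup>2 + 2 * (u \<bullet> v) + (?b / s)\<^sup>2"
      by (simp add: norm2_vec_sq[symmetric] power_mult_distrib power_divide)
    also have "\<dots> = ?b\<^sup>2 + 2 * (u \<bullet> v) + ?a\<^sup>2" unfolding sa sb ..
    also have "\<dots> = x \<bullet> x"
      unfolding split norm2_vec_sq using u v uv
      by (simp add: add_scalar_prod_distrib[of _ n] scalar_prod_add_distrib[of _ n])
    finally have nw: "norm2_vec w = norm2_vec x" unfolding norm2_vec_def by simp
    have sz: "(1 / s) \<cdot>\<^sub>v 0\<^sub>v n = (0\<^sub>v n :: real vec)" by (rule eq_vecI) auto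
    have "H *\<^sub>v w = s \<cdot>\<^sub>v u"
      unfolding w_def using u v
      by (simp add: mult_add_distrib_mat_vec[OF H] mult_mat_vec[OF H] Pu Pv sz)
    then have "?b = norm2_vec (H *\<^sub>v w)" using sa s by (simp add: norm2_vec_smult)
    also have "\<dots> \<le> spectral_norm H * norm2_vec w" by (rule norm2_vec_mult_le) (use w in simp)
    finally show ?thesis by (simp add: nw)
  qed
  then show "norm2_vec ((1\<^sub>m n - H) *\<^sub>v x) \<le> spectral_norm H * norm2_vec x"
    by (simp add: vx)
qed

section \<open>Gram matrices and column space projectors\<close>

lemma invertible_mat_injective:
  fixes M :: "real mat"
  assumes M: "M \<in> carrier_mat n n" and inv: "invertible_mat M"
    and v: "v \<in> carrier_vec n" and 0: "M *\<^sub>v v = 0\<^sub>v n"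
  shows "v = 0\<^sub>v n"
proof -
  note K = inv_mat[OF M inv]
  have "v = inv_mat M *\<^sub>v (M *\<^sub>v v)"
    using assoc_mult_mat_vec[OF K(3) M v] K(2) v by simp
  also have "\<dots> = 0\<^sub>v n" unfolding 0 using K(3) by auto
  finally show ?thesis .
qed

lemma invertible_mat_if_injective:
  fixes M :: "real mat"
  assumes M: "M \<in> carrier_mat n n"
    and inj: "\<And>v. v \<in> carrier_vec n \<Longrightarrow> M *\<^sub>v v = 0\<^sub>v n \<Longrightarrow> v = 0\<^sub>v n"
  shows "invertible_mat M"
proof -
  have "det M \<noteq> 0" using det_0_iff_vec_prod_zero[OF M] inj by auto
  then have "M \<in> Units (ring_mat TYPE(real) n ())" by (rule det_non_zero_imp_unit[OF M])
  then obtain B where "B \<in> carrier_mat n n" "M * B = 1\<^sub>m n" "B * M = 1\<^sub>m n"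
    unfolding Units_def ring_mat_simps by auto
  then show ?thesis using M unfolding invertible_mat_def inverts_mat_def by auto
qed

lemma invertible_gram_if_injective:
  fixes C :: "real mat"
  assumes C: "C \<in> carrier_mat r k"
    and inj: "\<And>v. v \<in> carrier_vec k \<Longrightarrow> C *\<^sub>v v = 0\<^sub>v r \<Longrightarrow> v = 0\<^sub>v k"
  shows "invertible_mat (transpose_mat C * C)"
proof (rule invertible_mat_if_injective)
  show "transpose_mat C * C \<in> carrier_mat k k" using C by simp
  fix v :: "real vec" assume v: "v \<in> carrier_vec k" and 0: "transpose_mat C * C *\<^sub>v v = 0\<^sub>v k"
  have "(norm2_vec (C *\<^sub>v v))\<^sup>2 = v \<bullet> (transpose_mat C * C *\<^sub>v v)"
    using C v by (subst norm2_vec_mult_sq) (auto simp: mult_vec_assoc_dim)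
  also have "\<dots> = 0" unfolding 0 using v by simp
  finally have "C *\<^sub>v v = 0\<^sub>v r" using C norm2_vec_eq_0_iff[of "C *\<^sub>v v"] by simp
  then show "v = 0\<^sub>v k" using inj v by simp
qed

text \<open>For \<open>C\<close> of full column rank \<open>E\<close> is \<open>C C\<^sup>+\<close>. Used with \<open>C = R\<^sup>T\<close>, the lemma also covers \<open>R\<^sup>+ R\<close>
  for \<open>R\<close> of full row rank.\<close>
lemma column_space_projector:
  assumes C: "C \<in> carrier_mat r k" and inv: "invertible_mat (transpose_mat C * C)"
    and E: "E = C * (inv_mat (transpose_mat C * C) * transpose_mat C)"
  shows "E \<in> carrier_mat r r" "transpose_mat E = E" "E * C = C" "E * E = E"
proof -
  let ?K = "inv_mat (transpose_mat C * C)"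
  have M: "transpose_mat C * C \<in> carrier_mat k k" using C by simp
  note K = inv_mat[OF M inv]
  have Ks: "transpose_mat ?K = ?K"
    by (rule transpose_inv_mat_sym[OF M inv]) (use C in \<open>simp add: transpose_mult_dim\<close>)
  have d[simp]: "dim_row C = r" "dim_col C = k" "dim_row ?K = k" "dim_col ?K = k" using C K(3) by auto
  show "E \<in> carrier_mat r r" unfolding E by (intro carrier_matI) simp_all
  show "transpose_mat E = E" unfolding E by (simp add: mat_dim_simps Ks)
  show EC: "E * C = C" unfolding E using K(2) by (simp add: mat_dim_simps)
  have "E * E = E * C * (?K * transpose_mat C)" unfolding E by (simp add: mat_dim_simps)
  also have "\<dots> = E" unfolding EC by (simp add: E)
  finally show "E * E = E" .
qed

text \<open>An orthogonal projector \<open>E\<close> that fixes the selected columns \<open>X P\<close> is compared with the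
  orthogonal projection of the rows of \<open>X\<close> onto the range of \<open>Q\<close>, at the price of the factor
  \<open>\<parallel>(Q\<^sup>T P)\<^sup>-\<^sup>1\<parallel>\<close>. As \<open>E\<close> fixes \<open>X P\<close>, the oblique projector \<open>H = P K Q\<^sup>T\<close> satisfies \<open>E X H = X H\<close>,
  so \<open>X - E X = (1 - E) X (1 - H)\<close>, and \<open>X Q Q\<^sup>T\<close> may be subtracted from \<open>X\<close> because \<open>Q\<^sup>T (1 - H) = 0\<close>.
  The inverse enters as a right inverse \<open>K\<close>, so that the transposed situation may supply
  the transpose of an inverse. The condition \<open>0 < k\<close> ensures \<open>H \<noteq> 0\<close>.\<close>
lemma oblique_projection_error:
  assumes X: "X \<in> carrier_mat r c" and Q: "Q \<in> carrier_mat c k" and P: "P \<in> carrier_mat c k"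
    and K: "K \<in> carrier_mat k k" and E: "E \<in> carrier_mat r r"
    and QQ: "transpose_mat Q * Q = 1\<^sub>m k" and PP: "transpose_mat P * P = 1\<^sub>m k"
    and QPK: "transpose_mat Q * P * K = 1\<^sub>m k"
    and proj: "transpose_mat E = E" "E * E = E" and EXP: "E * (X * P) = X * P"
    and k: "0 < k"
  shows "spectral_norm (X - E * X) \<le> spectral_norm (X - X * (Q * transpose_mat Q)) * spectral_norm K"
proof -
  define H where "H = P * (K * transpose_mat Q)"
  define Y where "Y = X - X * (Q * transpose_mat Q)"
  have d[simp]: "dim_row X = r" "dim_col X = c" "dim_row Q = c" "dim_col Q = k"
    "dim_row P = c" "dim_col P = k" "dim_row K = k" "dim_col K = k" "dim_row E = r" "dim_col E = r"
    using X Q P K E by auto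
  have dH[simp]: "dim_row H = c" "dim_col H = c" unfolding H_def by simp_all
  have dY[simp]: "dim_row Y = r" "dim_col Y = c" unfolding Y_def by simp_all
  have c1: "transpose_mat Q * (P * (K * M)) = M" if "dim_row M = k" for M
    using that arg_cong[OF QPK, of "\<lambda>N. N * M"] by (simp add: mat_dim_simps)
  have HH: "H * H = H" unfolding H_def by (simp add: mat_dim_simps c1)
  have QH: "transpose_mat Q * H = transpose_mat Q" unfolding H_def by (simp add: c1)
  have H0: "H \<noteq> 0\<^sub>m c c"
  proof
    assume "H = 0\<^sub>m c c"
    then have "transpose_mat Q = 0\<^sub>m k c" using QH by simp
    then have "(1\<^sub>m k :: real mat) = 0\<^sub>m k k" using QQ by simp
    from arg_cong[OF this, of "\<lambda>M. M $$ (0, 0)"] k show False by simp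
  qed
  have YH: "Y * (1\<^sub>m c - H) = X - X * H"
  proof -
    have "Y * H = X * H - X * (Q * transpose_mat Q)"
      unfolding Y_def by (simp add: mat_dim_simps QH)
    then have "Y * (1\<^sub>m c - H) = Y - (X * H - X * (Q * transpose_mat Q))" by (simp add: mat_dim_simps)
    also have "\<dots> = X - X * H" unfolding Y_def by (rule eq_matI) auto
    finally show ?thesis .
  qed
  have EXH: "E * (X * H) = X * H"
    using arg_cong[OF EXP, of "\<lambda>M. M * (K * transpose_mat Q)"] unfolding H_def by (simp add: mat_dim_simps)
  have factor: "X - E * X = (1\<^sub>m r - E) * (Y * (1\<^sub>m c - H))"
  proof -
    have "(1\<^sub>m r - E) * (X - X * H) = (X - X * H) - E * (X - X * H)"
      by (subst minus_mult_dim) simp_all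
    also have "E * (X - X * H) = E * X - X * H" by (simp add: mat_dim_simps EXH)
    also have "(X - X * H) - (E * X - X * H) = X - E * X" by (rule eq_matI) auto
    finally show ?thesis unfolding YH by simp
  qed
  have compl: "spectral_norm (1\<^sub>m r - E) \<le> 1"
  proof (rule spectral_norm_projector)
    show "transpose_mat (1\<^sub>m r - E) = 1\<^sub>m r - E" using proj by (simp add: mat_dim_simps)
    have "(1\<^sub>m r - E) * (1\<^sub>m r - E) = (1\<^sub>m r - E) - (E - E)" using proj by (simp add: mat_dim_simps)
    then show "(1\<^sub>m r - E) * (1\<^sub>m r - E) = 1\<^sub>m r - E" by (auto intro!: eq_matI)
  qed
  have nP: "spectral_norm P \<le> 1" by (rule spectral_norm_orthonormal_cols) (simp add: PP)
  have nQ: "spectral_norm (transpose_mat Q) \<le> 1"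
    unfolding spectral_norm_transpose by (rule spectral_norm_orthonormal_cols) (simp add: QQ)
  have "spectral_norm (1\<^sub>m c - H) \<le> spectral_norm H"
    by (rule spectral_norm_complement_idempotent[OF _ HH H0]) auto
  also have "spectral_norm H \<le> 1 * (spectral_norm K * 1)"
    unfolding H_def
    by (intro spectral_norm_mult_le nP nQ order_refl) simp_all
  finally have HK: "spectral_norm (1\<^sub>m c - H) \<le> spectral_norm K" by simp
  have "spectral_norm (X - E * X) \<le> 1 * (spectral_norm Y * spectral_norm K)"
    unfolding factor by (intro spectral_norm_mult_le compl HK order_refl) simp_all
  then show ?thesis unfolding Y_def by simp
qed

section \<open>Leading and trailing blocks\<close>

lemma dim_first_drop [simp]:
  "dim_row (first_cols k M) = dim_row M" "dim_col (first_cols k M) = k"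
  "dim_row (drop_cols k M) = dim_row M" "dim_col (drop_cols k M) = dim_col M - k"
  "dim_row (drop_rows k M) = dim_row M - k" "dim_col (drop_rows k M) = dim_col M"
  unfolding first_cols_def drop_cols_def drop_rows_def by simp_all

lemma col_first_cols: "j < k \<Longrightarrow> k \<le> dim_col M \<Longrightarrow> col (first_cols k M) j = col M j"
  unfolding first_cols_def by (intro eq_vecI) auto

lemma col_drop_cols: "j < dim_col M - k \<Longrightarrow> col (drop_cols k M) j = col M (j + k)"
  unfolding drop_cols_def by (intro eq_vecI) auto

lemma row_drop_rows: "i < dim_row M - k \<Longrightarrow> row (drop_rows k M) i = row M (i + k)"
  unfolding drop_rows_def by (intro eq_vecI) auto

lemma first_cols_mult:
  "dim_col M = dim_row N \<Longrightarrow> k \<le> dim_col N \<Longrightarrow> first_cols k (M * N) = M * first_cols k N"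
  by (rule eq_matI) (auto simp: col_first_cols, simp add: first_cols_def)

lemma drop_cols_mult: "dim_col M = dim_row N \<Longrightarrow> drop_cols k (M * N) = M * drop_cols k N"
  by (rule eq_matI) (auto simp: col_drop_cols, simp add: drop_cols_def)

lemma drop_rows_mult: "dim_col M = dim_row N \<Longrightarrow> drop_rows k (M * N) = drop_rows k M * N"
  by (rule eq_matI) (auto simp: row_drop_rows, simp add: drop_rows_def)

lemma mult_transpose_split_cols:
  assumes "dim_col M = dim_col N" "k \<le> dim_col N"
  shows "M * transpose_mat N = first_cols k M * transpose_mat (first_cols k N)
    + drop_cols k M * transpose_mat (drop_cols k N)"
proof (rule eq_matI; simp)
  fix i j assume ij: "i < dim_row M" "j < dim_row N"
  let ?n = "dim_col N"
  have "row M i \<bullet> row N j = (\<Sum>t\<in>{0..<?n}. M $$ (i, t) * N $$ (j, t))"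
    using ij assms by (simp add: scalar_prod_def)
  also have "\<dots> = (\<Sum>t\<in>{0..<k}. M $$ (i, t) * N $$ (j, t)) + (\<Sum>t\<in>{k..<?n}. M $$ (i, t) * N $$ (j, t))"
    using assms by (simp add: sum.atLeastLessThan_concat)
  also have "(\<Sum>t\<in>{k..<?n}. M $$ (i, t) * N $$ (j, t)) =
    (\<Sum>t\<in>{0..<?n - k}. M $$ (i, t + k) * N $$ (j, t + k))"
    using sum.shift_bounds_nat_ivl[of "\<lambda>t. M $$ (i, t) * N $$ (j, t)" 0 k "?n - k"] assms by simp
  finally show "row M i \<bullet> row N j = row (first_cols k M) i \<bullet> row (first_cols k N) j
      + row (drop_cols k M) i \<bullet> row (drop_cols k N) j"
    using ij assms by (simp add: scalar_prod_def first_cols_def drop_cols_def)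
qed

text \<open>This confines a product to the trailing blocks once the top rows of the second factor are
  known to vanish.\<close>
lemma mult_skip_zero_rows:
  assumes "dim_col M = dim_row N" "k \<le> dim_row N"
    and zero: "\<And>i j. i < k \<Longrightarrow> j < dim_col N \<Longrightarrow> N $$ (i, j) = 0"
  shows "M * N = drop_cols k M * drop_rows k N"
proof -
  have "first_cols k (transpose_mat N) = 0\<^sub>m (dim_col N) k"
    by (rule eq_matI) (use assms in \<open>auto simp: first_cols_def\<close>)
  moreover have "transpose_mat (drop_cols k (transpose_mat N)) = drop_rows k N"
    by (rule eq_matI) (auto simp: drop_cols_def drop_rows_def)
  moreover have "drop_cols k M * drop_rows k N \<in> carrier_mat (dim_row M) (dim_col N)"
    by (rule carrier_matI) simp_all
  ultimately show ?thesis
    using mult_transpose_split_cols[of M "transpose_mat N" k] assms(1,2) by simp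
qed

lemma orthonormal_first_cols:
  assumes QQ: "transpose_mat Q * Q = 1\<^sub>m n" and Q: "Q \<in> carrier_mat n n" and k: "k \<le> n"
  shows "transpose_mat (first_cols k Q) * first_cols k Q = 1\<^sub>m k"
proof (rule eq_matI; simp)
  fix i j assume ij: "i < k" "j < k"
  have "(transpose_mat Q * Q) $$ (i, j) = (if i = j then 1 else 0)" unfolding QQ using ij k by simp
  then show "(i = j \<longrightarrow> col (first_cols k Q) j \<bullet> col (first_cols k Q) j = 1) \<and>
      (i \<noteq> j \<longrightarrow> col (first_cols k Q) i \<bullet> col (first_cols k Q) j = 0)"
    using ij k Q by (auto simp: col_first_cols)
qed

lemma orthonormal_drop_cols:
  assumes QQ: "transpose_mat Q * Q = 1\<^sub>m n" and Q: "Q \<in> carrier_mat n n"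
  shows "transpose_mat (drop_cols k Q) * drop_cols k Q = 1\<^sub>m (n - k)"
proof (rule eq_matI)
  fix i j assume "i < dim_row (1\<^sub>m (n - k) :: real mat)" "j < dim_col (1\<^sub>m (n - k) :: real mat)"
  then have ij: "i < n - k" "j < n - k" by auto
  have "(transpose_mat Q * Q) $$ (i + k, j + k) = (if i = j then 1 else 0)" unfolding QQ using ij by simp
  then show "(transpose_mat (drop_cols k Q) * drop_cols k Q) $$ (i, j) = (1\<^sub>m (n - k) :: real mat) $$ (i, j)"
    using ij Q by (auto simp: col_drop_cols)
qed (use Q in auto)

lemma orthonormal_index_selection:
  assumes "is_index_selection r k S"
  shows "transpose_mat S * S = 1\<^sub>m k"
proof (rule eq_matI)
  have S: "S \<in> carrier_mat r k" and dist: "distinct (cols S)" and sub: "set (cols S) \<subseteq> set (cols (1\<^sub>m r))"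
    using assms unfolding is_index_selection_def by auto
  have unit: "\<exists>p<r. col S i = unit_vec r p" if "i < k" for i
  proof -
    have "col S i \<in> set (cols (1\<^sub>m r))" using that S sub by (auto simp: cols_def)
    then show ?thesis by (auto simp: cols_def)
  qed
  fix i j assume "i < dim_row (1\<^sub>m k :: real mat)" "j < dim_col (1\<^sub>m k :: real mat)"
  then have ij: "i < k" "j < k" by auto
  obtain p q where pq: "p < r" "col S i = unit_vec r p" "q < r" "col S j = unit_vec r q"
    using unit ij by blast
  have "col S i = col S j \<longleftrightarrow> i = j"
    using dist ij S nth_eq_iff_index_eq[OF dist, of i j] by simp
  then have "p = q \<longleftrightarrow> i = j" using pq by auto
  then show "(transpose_mat S * S) $$ (i, j) = (1\<^sub>m k :: real mat) $$ (i, j)"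
    using ij S pq by auto
qed (use assms in \<open>auto simp: is_index_selection_def\<close>)

text \<open>With \<open>M = L D T\<^sub>N\<^sup>T\<close>, so that \<open>X = M Q\<^sub>N\<^sup>T\<close>, removing the projection onto the first \<open>k\<close> columns of
  \<open>Q\<^sub>N\<close> leaves the last columns of \<open>M\<close> against those of \<open>Q\<^sub>N\<close>. The last columns \<open>F\<close> of the lower
  triangular \<open>T\<^sub>N\<^sup>T\<close> begin with \<open>k\<close> zero rows, and multiplication by the diagonal \<open>D\<close> preserves these.
  Hence the leading columns of \<open>D\<close>, and then those of \<open>L\<close>, drop out.\<close>
lemma trailing_part_norm:
  assumes L: "is_QR r L Q_L T_L" and N: "is_QR c N Q_N T_N"
    and D: "D \<in> carrier_mat r c" "diagonal_mat D" and k: "k \<le> r" "k \<le> c" and \<delta>: "0 \<le> \<delta>"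
    and D\<delta>: "\<And>i. k \<le> i \<Longrightarrow> i < r \<Longrightarrow> i < c \<Longrightarrow> \<bar>D $$ (i, i)\<bar> \<le> \<delta>"
    and X: "X = L * D * transpose_mat N" and Q: "Q = first_cols k Q_N"
  shows "spectral_norm (X - X * (Q * transpose_mat Q)) \<le>
    \<delta> * (spectral_norm (drop_cols k T_L) * spectral_norm (drop_rows k (drop_cols k T_N)))"
proof -
  have QLc: "Q_L \<in> carrier_mat r r" and TLc: "T_L \<in> carrier_mat r r" and LQ: "L = Q_L * T_L"
    and QL: "transpose_mat Q_L * Q_L = 1\<^sub>m r"
    using L unfolding is_QR_def is_orthogonal_def by auto
  have QNc: "Q_N \<in> carrier_mat c c" and TNc: "T_N \<in> carrier_mat c c" and NQ: "N = Q_N * T_N"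
    and up: "upper_triangular T_N" and QN: "transpose_mat Q_N * Q_N = 1\<^sub>m c"
    using N unfolding is_QR_def is_orthogonal_def by auto
  have d[simp]: "dim_row Q_L = r" "dim_col Q_L = r" "dim_row T_L = r" "dim_col T_L = r"
    "dim_row Q_N = c" "dim_col Q_N = c" "dim_row T_N = c" "dim_col T_N = c"
    "dim_row D = r" "dim_col D = c" "dim_row L = r" "dim_col L = r"
    using QLc TLc QNc TNc D LQ by auto
  define M where "M = L * (D * transpose_mat T_N)"
  have dM[simp]: "dim_row M = r" "dim_col M = c" unfolding M_def by simp_all
  have XM: "X = M * transpose_mat Q_N" unfolding X M_def NQ by (simp add: mat_dim_simps)
  have "X * Q = M * first_cols k (transpose_mat Q_N * Q_N)"
    unfolding XM Q using k by (simp add: mat_dim_simps first_cols_mult)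
  also have "\<dots> = first_cols k M" using k QN by (simp flip: first_cols_mult)
  finally have "X * (Q * transpose_mat Q) = first_cols k M * transpose_mat Q"
    using Q by (simp add: XM flip: mult_assoc_dim)
  then have eq: "X - X * (Q * transpose_mat Q) = drop_cols k M * transpose_mat (drop_cols k Q_N)"
    using mult_transpose_split_cols[of M Q_N k] k unfolding XM[symmetric] Q[symmetric]
    by (auto intro!: eq_matI simp: Q)
  define F where "F = drop_cols k (transpose_mat T_N)"
  have dF[simp]: "dim_row F = c" "dim_col F = c - k" unfolding F_def by simp_all
  have F0: "F $$ (i, j) = 0" if "i < k" "j < c - k" for i j
    using that up k unfolding F_def drop_cols_def by (auto intro!: upper_triangularD)
  have DF0: "(D * F) $$ (i, j) = 0" if "i < k" "j < c - k" for i j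
  proof -
    have "(D * F) $$ (i, j) = (\<Sum>t\<in>{0..<c}. D $$ (i, t) * F $$ (t, j))"
      using that k by (simp add: scalar_prod_def)
    also have "\<dots> = 0"
    proof (rule sum.neutral, safe)
      fix t assume "t \<in> {0..<c}"
      then show "D $$ (i, t) * F $$ (t, j) = 0"
        using that k D(2) F0[OF that] by (cases "t = i") (auto simp: diagonal_mat_def)
    qed
    finally show ?thesis .
  qed
  have FT: "drop_rows k F = transpose_mat (drop_rows k (drop_cols k T_N))"
    unfolding F_def by (rule eq_matI) (auto simp: drop_rows_def drop_cols_def)
  have "drop_cols k M = L * (D * F)" unfolding M_def F_def by (simp add: drop_cols_mult)
  also have "\<dots> = drop_cols k L * drop_rows k (D * F)"
    by (rule mult_skip_zero_rows) (use DF0 k in auto)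
  also have "drop_rows k (D * F) = drop_rows k D * F" by (simp add: drop_rows_mult)
  also have "\<dots> = drop_cols k (drop_rows k D) * drop_rows k F"
    by (rule mult_skip_zero_rows) (use F0 k in auto)
  also have "drop_cols k L = Q_L * drop_cols k T_L" unfolding LQ by (simp add: drop_cols_mult)
  finally have Mk: "drop_cols k M = (Q_L * drop_cols k T_L) *
    (drop_cols k (drop_rows k D) * transpose_mat (drop_rows k (drop_cols k T_N)))"
    unfolding FT .
  have nD: "spectral_norm (drop_cols k (drop_rows k D)) \<le> \<delta>"
    by (rule spectral_norm_diagonal[OF _ \<delta>])
      (use D(2) D\<delta> in \<open>auto simp: diagonal_mat_def drop_cols_def drop_rows_def\<close>)
  have nQL: "spectral_norm Q_L \<le> 1" by (rule spectral_norm_orthonormal_cols) (simp add: QL)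
  have nQN: "spectral_norm (transpose_mat (drop_cols k Q_N)) \<le> 1"
    unfolding spectral_norm_transpose
    by (rule spectral_norm_orthonormal_cols) (simp add: orthonormal_drop_cols[OF QN QNc])
  have "spectral_norm (X - X * (Q * transpose_mat Q)) \<le> ((1 * spectral_norm (drop_cols k T_L)) *
      (\<delta> * spectral_norm (drop_rows k (drop_cols k T_N)))) * 1"
    unfolding eq Mk
    by (intro spectral_norm_mult_le nD nQL nQN order_refl) (simp_all add: spectral_norm_transpose)
  then show ?thesis by (simp add: mult_ac)
qed

text \<open>If \<open>X P w = 0\<close>, then \<open>D N\<^sup>T P w = 0\<close> as \<open>L\<close> is nonsingular, so the first \<open>k\<close> entries of
  \<open>N\<^sup>T P w = T\<^sub>N\<^sup>T (Q\<^sub>N\<^sup>T P w)\<close> vanish. The matrix \<open>T\<^sub>N\<^sup>T\<close> is lower triangular with nonzero diagonal, so forward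
  substitution shows that the first \<open>k\<close> entries of \<open>Q\<^sub>N\<^sup>T P w\<close> vanish too, and these
  form the vector \<open>(Q\<^sup>T P) w\<close> for the matrix \<open>Q\<close> of the first \<open>k\<close> columns of \<open>Q\<^sub>N\<close>.\<close>
lemma selected_columns_injective:
  assumes L: "L \<in> carrier_mat r r" "invertible_mat L" and N: "is_QR c N Q_N T_N" "invertible_mat N"
    and D: "D \<in> carrier_mat r c" "diagonal_mat D" and k: "k \<le> r" "k \<le> c"
    and D0: "\<And>i. i < k \<Longrightarrow> D $$ (i, i) \<noteq> 0"
    and X: "X = L * D * transpose_mat N" and P: "P \<in> carrier_mat c k"
    and inv: "invertible_mat (transpose_mat (first_cols k Q_N) * P)"
    and w: "w \<in> carrier_vec k" and 0: "(X * P) *\<^sub>v w = 0\<^sub>v r"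
  shows "w = 0\<^sub>v k"
proof -
  have Qc: "Q_N \<in> carrier_mat c c" and Tc: "T_N \<in> carrier_mat c c" and NQ: "N = Q_N * T_N"
    and up: "upper_triangular T_N"
    using N(1) unfolding is_QR_def is_orthogonal_def by auto
  have d[simp]: "dim_row Q_N = c" "dim_col Q_N = c" "dim_row T_N = c" "dim_col T_N = c"
    "dim_row D = r" "dim_col D = c" "dim_row L = r" "dim_col L = r" "dim_row P = c" "dim_col P = k"
    "dim_vec w = k"
    using Qc Tc D L P w by auto
  define x where "x = transpose_mat Q_N *\<^sub>v (P *\<^sub>v w)"
  define y where "y = transpose_mat T_N *\<^sub>v x"
  have dx[simp]: "dim_vec x = c" "dim_vec y = c" unfolding x_def y_def by simp_all
  have "L *\<^sub>v (D *\<^sub>v y) = 0\<^sub>v r"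
    using 0 unfolding X NQ y_def x_def by (simp add: mat_dim_simps)
  then have Dy: "D *\<^sub>v y = 0\<^sub>v r"
    by (rule invertible_mat_injective[OF L, rotated]) simp
  have y0: "y $ i = 0" if i: "i < k" for i
  proof -
    have "0 = (D *\<^sub>v y) $ i" unfolding Dy using i k by simp
    also have "\<dots> = (\<Sum>j\<in>{0..<c}. D $$ (i, j) * y $ j)" using i k by (simp add: scalar_prod_def)
    also have "\<dots> = (\<Sum>j\<in>{0..<c}. if j = i then D $$ (i, i) * y $ i else 0)"
      using D(2) i k by (intro sum.cong) (auto simp: diagonal_mat_def)
    also have "\<dots> = D $$ (i, i) * y $ i" using i k by simp
    finally show ?thesis using D0[OF i] by simp
  qed
  have Nc: "N \<in> carrier_mat c c" unfolding NQ using Qc Tc by simp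
  have "det N * det (inv_mat N) = 1"
    using inv_mat[OF Nc N(2)] det_mult[OF Nc, of "inv_mat N"] by simp
  then have "det T_N \<noteq> 0" unfolding NQ det_mult[OF Qc Tc] by auto
  then have T0: "T_N $$ (i, i) \<noteq> 0" if "i < c" for i
    using that upper_triangular_imp_det_eq_0_iff[OF Tc up] by (auto simp: diag_mat_def)
  have x0: "x $ i = 0" if "i < k" for i
    using that
  proof (induction i rule: less_induct)
    case (less i)
    have "0 = y $ i" using y0 less.prems by simp
    also have "\<dots> = (\<Sum>j\<in>{0..<c}. T_N $$ (j, i) * x $ j)"
      unfolding y_def using less.prems k by (simp add: scalar_prod_def)
    also have "\<dots> = (\<Sum>j\<in>{0..<c}. if j = i then T_N $$ (i, i) * x $ i else 0)"
    proof (rule sum.cong[OF refl])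
      fix j assume j: "j \<in> {0..<c}"
      consider "j < i" | "j = i" | "i < j" by linarith
      then show "T_N $$ (j, i) * x $ j = (if j = i then T_N $$ (i, i) * x $ i else 0)"
      proof cases
        case 1
        then show ?thesis using less by simp
      next
        case 3
        then show ?thesis using upper_triangularD[OF up] j by simp
      qed simp
    qed
    also have "\<dots> = T_N $$ (i, i) * x $ i" using less.prems k by simp
    finally show ?case using T0[of i] less.prems k by simp
  qed
  have "transpose_mat (first_cols k Q_N) * P *\<^sub>v w = 0\<^sub>v k"
  proof (rule eq_vecI)
    fix i assume "i < dim_vec (0\<^sub>v k :: real vec)"
    then have i: "i < k" by simp
    have "(transpose_mat (first_cols k Q_N) *\<^sub>v (P *\<^sub>v w)) $ i = x $ i"
      unfolding x_def using i k by (simp add: col_first_cols)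
    then show "(transpose_mat (first_cols k Q_N) * P *\<^sub>v w) $ i = (0\<^sub>v k :: real vec) $ i"
      using x0 i by (simp add: mat_dim_simps)
  qed simp
  then show ?thesis
    using invertible_mat_injective[OF _ inv w] by (simp add: carrier_matI)
qed

section \<open>CUR approximation of a matrix with a diagonal middle factor\<close>

text \<open>The hypotheses are symmetric in the two sides: transposition exchanges \<open>(L, S)\<close> and
  \<open>(N, P)\<close>. So the row error below uses the same lemmas as the column error, applied to \<open>X\<^sup>T\<close>.\<close>
theorem CUR_error_diagonal_factorization:
  assumes L: "is_QR r L Q_L T_L" "invertible_mat L" and N: "is_QR c N Q_N T_N" "invertible_mat N"
    and D: "D \<in> carrier_mat r c" "diagonal_mat D" and k: "0 < k" "k \<le> r" "k \<le> c"
    and D0: "\<And>i. i < k \<Longrightarrow> D $$ (i, i) \<noteq> 0" and \<delta>: "0 \<le> \<delta>"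
    and D\<delta>: "\<And>i. k \<le> i \<Longrightarrow> i < r \<Longrightarrow> i < c \<Longrightarrow> \<bar>D $$ (i, i)\<bar> \<le> \<delta>"
    and X: "X = L * D * transpose_mat N"
    and P: "is_index_selection c k P" and S: "is_index_selection r k S"
    and Q: "Q = first_cols k Q_N" and Q': "Q' = first_cols k Q_L"
    and invP: "invertible_mat (transpose_mat Q * P)" and invS: "invertible_mat (transpose_mat S * Q')"
  shows "spectral_norm (X - CUR_approx X P S) \<le>
    \<delta> * (spectral_norm (inv_mat (transpose_mat Q * P)) *
           spectral_norm (drop_cols k T_L) * spectral_norm (drop_rows k (drop_cols k T_N))
       + spectral_norm (inv_mat (transpose_mat S * Q')) *
           spectral_norm (drop_rows k (drop_cols k T_L)) * spectral_norm (drop_cols k T_N))"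
proof -
  have Lc: "L \<in> carrier_mat r r" and QLc: "Q_L \<in> carrier_mat r r" and QL: "transpose_mat Q_L * Q_L = 1\<^sub>m r"
    using L(1) unfolding is_QR_def is_orthogonal_def by auto
  have Nc: "N \<in> carrier_mat c c" and QNc: "Q_N \<in> carrier_mat c c" and QN: "transpose_mat Q_N * Q_N = 1\<^sub>m c"
    using N(1) unfolding is_QR_def is_orthogonal_def by auto
  have Pc: "P \<in> carrier_mat c k" and Sc: "S \<in> carrier_mat r k"
    using P S unfolding is_index_selection_def by auto
  have d[simp]: "dim_row L = r" "dim_col L = r" "dim_row N = c" "dim_col N = c"
    "dim_row D = r" "dim_col D = c" "dim_row P = c" "dim_col P = k" "dim_row S = r" "dim_col S = k"
    "dim_row Q = c" "dim_col Q = k" "dim_row Q' = r" "dim_col Q' = k"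
    using Lc Nc D Pc Sc QNc QLc Q Q' by auto
  have dX[simp]: "dim_row X = r" "dim_col X = c" unfolding X by simp_all
  let ?D = "transpose_mat D" and ?X = "transpose_mat X"
  have Dt: "?D \<in> carrier_mat c r" "diagonal_mat ?D" using D by (auto simp: diagonal_mat_def)
  have Xt: "?X = N * ?D * transpose_mat L" unfolding X by (simp add: mat_dim_simps)
  have Qc: "Q \<in> carrier_mat c k" and Q'c: "Q' \<in> carrier_mat r k" by (auto intro!: carrier_matI)
  have SQ: "transpose_mat S * Q' \<in> carrier_mat k k" and QP: "transpose_mat Q * P \<in> carrier_mat k k"
    by (auto intro!: carrier_matI)
  have tSQ: "transpose_mat Q' * S = transpose_mat (transpose_mat S * Q')" by (simp add: mat_dim_simps)
  note KP = inv_mat[OF QP invP] and KS = inv_mat[OF SQ invS]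
  (* the right inverse that the column estimate for the transpose of X asks for *)
  define K where "K = transpose_mat (inv_mat (transpose_mat S * Q'))"
  have Kc: "K \<in> carrier_mat k k" unfolding K_def using KS(3) by simp
  have QSK: "transpose_mat Q' * S * K = 1\<^sub>m k"
    unfolding tSQ K_def using KS by (simp flip: transpose_mult_dim)
  have KQS: "K * (transpose_mat Q' * S) = 1\<^sub>m k"
    unfolding tSQ K_def using KS by (simp flip: transpose_mult_dim)
  have invS': "invertible_mat (transpose_mat Q' * S)"
    unfolding invertible_mat_def inverts_mat_def using QSK KQS Kc by auto
  define C where "C = X * P"
  define R where "R = transpose_mat S * X"
  have Cc: "C \<in> carrier_mat r k" unfolding C_def by (auto intro!: carrier_matI)
  have Rt: "transpose_mat R = ?X * S" unfolding R_def by (simp add: mat_dim_simps)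
  have Rtc: "transpose_mat R \<in> carrier_mat c k" unfolding Rt by (auto intro!: carrier_matI)
  have invC: "invertible_mat (transpose_mat C * C)"
  proof (rule invertible_gram_if_injective[OF Cc])
    fix v :: "real vec" assume v: "v \<in> carrier_vec k" "C *\<^sub>v v = 0\<^sub>v r"
    show "v = 0\<^sub>v k"
      by (rule selected_columns_injective[OF Lc L(2) N D k(2,3) D0 X Pc _ v(1)])
        (use v invP in \<open>auto simp: C_def Q\<close>)
  qed
  have invR: "invertible_mat (transpose_mat (transpose_mat R) * transpose_mat R)"
  proof (rule invertible_gram_if_injective[OF Rtc])
    fix v :: "real vec" assume v: "v \<in> carrier_vec k" "transpose_mat R *\<^sub>v v = 0\<^sub>v c"
    show "v = 0\<^sub>v k"
      by (rule selected_columns_injective[OF Nc N(2) L Dt k(3,2) _ Xt Sc _ v(1)])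
        (use v invS' D0 k in \<open>auto simp: Rt Q'\<close>)
  qed
  define E where "E = C * pinv C"
  define F where "F = pinv R * R"
  have E: "E = C * (inv_mat (transpose_mat C * C) * transpose_mat C)"
    unfolding E_def pinv_full_column_rank[OF invC] ..
  have Fc: "F = transpose_mat R * (inv_mat (transpose_mat (transpose_mat R) * transpose_mat R)
      * transpose_mat (transpose_mat R))"
  proof -
    have RR: "R * transpose_mat R \<in> carrier_mat k k" using Rtc by auto
    show ?thesis
      using invR inv_mat(3)[OF RR] Rtc unfolding F_def
      by (simp add: pinv_full_row_rank mult_assoc_dim)
  qed
  note Ep = column_space_projector[OF Cc invC E] and Fp = column_space_projector[OF Rtc invR Fc]
  have dEF[simp]: "dim_row E = r" "dim_col E = r" "dim_row F = c" "dim_col F = c"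
    using Ep(1) Fp(1) by auto
  have QQ: "transpose_mat Q * Q = 1\<^sub>m k" unfolding Q by (rule orthonormal_first_cols[OF QN QNc k(3)])
  have QQ': "transpose_mat Q' * Q' = 1\<^sub>m k" unfolding Q' by (rule orthonormal_first_cols[OF QL QLc k(2)])
  let ?TL = "drop_cols k T_L" and ?TN = "drop_cols k T_N"
  have 1: "spectral_norm (X - E * X) \<le> \<delta> * (spectral_norm ?TL * spectral_norm (drop_rows k ?TN)) *
      spectral_norm (inv_mat (transpose_mat Q * P))"
  proof -
    have "spectral_norm (X - E * X) \<le> spectral_norm (X - X * (Q * transpose_mat Q)) *
      spectral_norm (inv_mat (transpose_mat Q * P))"
      by (rule oblique_projection_error[OF _ Qc Pc KP(3) Ep(1) QQ orthonormal_index_selection[OF P]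
            KP(1) Ep(2,4) _ k(1)]) (use Ep(3) in \<open>auto simp: C_def intro!: carrier_matI\<close>)
    also have "\<dots> \<le> \<delta> * (spectral_norm ?TL * spectral_norm (drop_rows k ?TN)) *
      spectral_norm (inv_mat (transpose_mat Q * P))"
      by (intro mult_right_mono trailing_part_norm[OF L(1) N(1) D k(2,3) \<delta> D\<delta> X Q])
        (auto simp: spectral_norm_nonneg)
    finally show ?thesis .
  qed
  have 2: "spectral_norm (X - X * F) \<le> \<delta> * (spectral_norm ?TN * spectral_norm (drop_rows k ?TL)) *
      spectral_norm (inv_mat (transpose_mat S * Q'))"
  proof -
    have "transpose_mat (X - X * F) = ?X - F * ?X" using Fp(2) by (simp add: mat_dim_simps)
    then have "spectral_norm (X - X * F) = spectral_norm (?X - F * ?X)"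
      using spectral_norm_transpose[of "X - X * F"] by simp
    also have "\<dots> \<le> spectral_norm (?X - ?X * (Q' * transpose_mat Q')) * spectral_norm K"
      by (rule oblique_projection_error[OF _ Q'c Sc Kc Fp(1) QQ' orthonormal_index_selection[OF S]
            QSK Fp(2,4) _ k(1)]) (use Fp(3) in \<open>auto simp: Rt intro!: carrier_matI\<close>)
    also have "\<dots> \<le> \<delta> * (spectral_norm ?TN * spectral_norm (drop_rows k ?TL)) * spectral_norm K"
      by (intro mult_right_mono trailing_part_norm[OF N(1) L(1) Dt k(3,2) \<delta> _ Xt Q'])
        (use D\<delta> in \<open>auto simp: spectral_norm_nonneg\<close>)
    finally show ?thesis unfolding K_def spectral_norm_transpose .
  qed
  have dCR: "dim_row C = r" "dim_col C = k" "dim_row R = k" "dim_col R = c" using Cc Rtc by auto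
  have "inv_mat (transpose_mat C * C) \<in> carrier_mat k k"
    by (rule inv_mat(3)[OF _ invC]) (use dCR in \<open>auto intro!: carrier_matI\<close>)
  moreover have "inv_mat (R * transpose_mat R) \<in> carrier_mat k k"
    by (rule inv_mat(3)) (use dCR invR in \<open>auto intro!: carrier_matI\<close>)
  ultimately have dp: "dim_row (pinv C) = k" "dim_col (pinv C) = r" "dim_row (pinv R) = c" "dim_col (pinv R) = k"
    using dCR invR by (simp_all add: pinv_full_column_rank[OF invC] pinv_full_row_rank)
  have "CUR_approx X P S = E * (X * F)"
    unfolding CUR_approx_def CUR_middle_def Let_def C_def[symmetric] R_def[symmetric] E_def F_def
    using dp dCR by (simp add: mat_dim_simps)
  then have "X - CUR_approx X P S = (X - E * X) + E * (X - X * F)"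
    by (auto intro!: eq_matI simp: mat_dim_simps)
  then have "spectral_norm (X - CUR_approx X P S) \<le> spectral_norm (X - E * X) + spectral_norm (E * (X - X * F))"
    by (simp add: spectral_norm_triangle)
  also have "spectral_norm (E * (X - X * F)) \<le> 1 * spectral_norm (X - X * F)"
    by (intro spectral_norm_mult_le spectral_norm_projector Ep order_refl) simp
  finally show ?thesis using 1 2 by (simp add: algebra_simps)
qed

section \<open>The restricted singular value decomposition\<close>

lemma spectral_norm_drop_rows: "spectral_norm (drop_rows k M) \<le> spectral_norm M"
proof -
  let ?J = "drop_cols k (1\<^sub>m (dim_row M)) :: real mat"
  have "transpose_mat ?J = drop_rows k (1\<^sub>m (dim_row M))"
    by (rule eq_matI) (auto simp: drop_cols_def drop_rows_def)
  then have J: "drop_rows k M = transpose_mat ?J * M"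
    using drop_rows_mult[of "1\<^sub>m (dim_row M)" M k] by simp
  have "spectral_norm (transpose_mat ?J) \<le> 1"
    unfolding spectral_norm_transpose
    by (rule spectral_norm_orthonormal_cols)
      (simp add: orthonormal_drop_cols[of "1\<^sub>m (dim_row M)" "dim_row M"])
  then have "spectral_norm (transpose_mat ?J * M) \<le> 1 * spectral_norm M"
    by (intro spectral_norm_mult_le order_refl) simp_all
  then show ?thesis unfolding J by simp
qed

lemma orthogonal_is_QR: "is_orthogonal n Q \<Longrightarrow> is_QR n Q Q (1\<^sub>m n)"
  unfolding is_QR_def by (auto simp: is_orthogonal_def)

lemma orthogonal_invertible: "is_orthogonal n Q \<Longrightarrow> invertible_mat Q"
  unfolding is_orthogonal_def invertible_mat_def inverts_mat_def by auto

lemma antimono_from_steps: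
  fixes f :: "nat \<Rightarrow> real"
  assumes "\<forall>i\<in>{1..<n}. f (i + 1) \<le> f i" and "1 \<le> a" "a \<le> b" "b \<le> n"
  shows "f b \<le> f a"
  using assms(3,4)
proof (induction b rule: dec_induct)
  case (step b)
  then have "f (b + 1) \<le> f b" using assms(1,2) by auto
  then show ?case using step by simp
qed simp

theorem theorem3p4:
  fixes m n l d k :: nat
    and A B G U V Z W Q_Z T_Z Q_W T_W S P P_B S_G :: "real mat"
    and \<alpha> \<beta> \<gamma> :: "nat \<Rightarrow> real"
    and T_Z_hat T_Z22 T_W_hat T_W22 Q_Zk Q_Wk U_k V_k :: "real mat"
    and \<eta>_p \<eta>_s \<eta>_pB \<eta>_sG :: real
  assumes dims: "l = d" "d \<ge> m" "m \<ge> n" and k: "1 \<le> k" "k < n"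
    and A: "A \<in> carrier_mat m n"
    and B: "B \<in> carrier_mat m l" "vec_space.rank m B = m"
    and G: "G \<in> carrier_mat d n" "vec_space.rank d G = n"
    and rsvd: "is_RSVD m n l d A B G U V Z W \<alpha> \<beta> \<gamma>"
    and qr_Z: "is_QR m Z Q_Z T_Z"
    and qr_W: "is_QR n W Q_W T_W"
    and sel: "is_index_selection m k S" "is_index_selection n k P"
      "is_index_selection l k P_B" "is_index_selection d k S_G"
    and blocks: "U_k = first_cols k U" "V_k = first_cols k V"
      "Q_Zk = first_cols k Q_Z" "Q_Wk = first_cols k Q_W"
      "T_Z_hat = drop_cols k T_Z" "T_Z22 = drop_rows k T_Z_hat"
      "T_W_hat = drop_cols k T_W" "T_W22 = drop_rows k T_W_hat"
    and nonsing: "invertible_mat (transpose_mat Q_Wk * P)"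
      "invertible_mat (transpose_mat U_k * P_B)"
      "invertible_mat (transpose_mat S_G * V_k)"
      "invertible_mat (transpose_mat S * Q_Zk)"
    and eta: "\<eta>_p = spectral_norm (inv_mat (transpose_mat Q_Wk * P))"
      "\<eta>_s = spectral_norm (inv_mat (transpose_mat S * Q_Zk))"
      "\<eta>_pB = spectral_norm (inv_mat (transpose_mat U_k * P_B))"
      "\<eta>_sG = spectral_norm (inv_mat (transpose_mat S_G * V_k))"
  shows
    "spectral_norm (A - CUR_approx A P S)
       \<le> \<alpha> (k + 1) * (\<eta>_p * spectral_norm T_Z_hat * spectral_norm T_W22
                      + \<eta>_s * spectral_norm T_Z22 * spectral_norm T_W_hat)
     \<and> \<alpha> (k + 1) * (\<eta>_p * spectral_norm T_Z_hat * spectral_norm T_W22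
                      + \<eta>_s * spectral_norm T_Z22 * spectral_norm T_W_hat)
       \<le> \<alpha> (k + 1) * (\<eta>_p + \<eta>_s) * spectral_norm T_W_hat * spectral_norm T_Z_hat
     \<and> spectral_norm (B - CUR_approx B P_B S)
       \<le> \<eta>_pB * spectral_norm T_Z_hat + \<eta>_s * spectral_norm T_Z22
     \<and> \<eta>_pB * spectral_norm T_Z_hat + \<eta>_s * spectral_norm T_Z22
       \<le> (\<eta>_pB + \<eta>_s) * spectral_norm T_Z_hat
     \<and> spectral_norm (G - CUR_approx G P S_G)
       \<le> \<gamma> (k + 1) * (\<eta>_p * spectral_norm T_W22 + \<eta>_sG * spectral_norm T_W_hat)
     \<and> \<gamma> (k + 1) * (\<eta>_p * spectral_norm T_W22 + \<eta>_sG * spectral_norm T_W_hat)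
       \<le> \<gamma> (k + 1) * (\<eta>_p + \<eta>_sG) * spectral_norm T_W_hat"
proof -
  have U: "is_orthogonal l U" and V: "is_orthogonal d V"
    and Z: "invertible_mat Z" and W: "invertible_mat W"
    and Af: "A = Z * rsvd_diag m n \<alpha> * transpose_mat W"
    and Bf: "B = Z * rsvd_DB m n l \<beta> * transpose_mat U"
    and Gf: "G = V * rsvd_diag d n \<gamma> * transpose_mat W"
    and bnd: "\<And>i. 1 \<le> i \<Longrightarrow> i \<le> n \<Longrightarrow> 0 < \<alpha> i \<and> 0 < \<beta> i \<and> \<beta> i < 1 \<and> 0 < \<gamma> i"
    and mono: "\<forall>i\<in>{1..<n}. \<alpha> (i + 1) \<le> \<alpha> i" "\<forall>i\<in>{1..<n}. \<gamma> (i + 1) \<le> \<gamma> i"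
    using rsvd unfolding is_RSVD_def by auto
  have a0: "0 < \<alpha> (k + 1)" and c0: "0 < \<gamma> (k + 1)" using bnd[of "k + 1"] k by auto
  let ?n = spectral_norm
  let ?I = "drop_cols k (1\<^sub>m l) :: real mat"
  have nI: "?n ?I \<le> 1"
    by (rule spectral_norm_orthonormal_cols) (simp add: orthonormal_drop_cols[of "1\<^sub>m l" l])
  have nI2: "?n (drop_rows k ?I) \<le> 1"
    using spectral_norm_drop_rows[of k ?I] nI by linarith
  have Z22: "?n T_Z22 \<le> ?n T_Z_hat" and W22: "?n T_W22 \<le> ?n T_W_hat"
    unfolding blocks by (rule spectral_norm_drop_rows)+
  have eta0: "0 \<le> \<eta>_p" "0 \<le> \<eta>_s" "0 \<le> \<eta>_pB" "0 \<le> \<eta>_sG"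
    unfolding eta by (simp_all add: spectral_norm_nonneg)
  have n0: "0 \<le> ?n T_Z_hat" "0 \<le> ?n T_Z22" "0 \<le> ?n T_W_hat" "0 \<le> ?n T_W22"
    by (simp_all add: spectral_norm_nonneg)
  have UQ: "is_QR l U U (1\<^sub>m l)" and VQ: "is_QR d V V (1\<^sub>m d)"
    using U V orthogonal_is_QR by auto
  have A1: "?n (A - CUR_approx A P S)
      \<le> \<alpha> (k + 1) * (\<eta>_p * ?n T_Z_hat * ?n T_W22 + \<eta>_s * ?n T_Z22 * ?n T_W_hat)"
    unfolding eta blocks(5-8)
  proof (rule CUR_error_diagonal_factorization[OF qr_Z Z qr_W W _ _ _ _ _ _ _ _ Af sel(2,1)
        blocks(4,3) nonsing(1,4)])
    show "rsvd_diag m n \<alpha> $$ (i, i) \<noteq> 0" if "i < k" for i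
      using that k dims bnd[of "i + 1"] by (simp add: rsvd_diag_def)
    show "\<bar>rsvd_diag m n \<alpha> $$ (i, i)\<bar> \<le> \<alpha> (k + 1)" if "k \<le> i" "i < m" "i < n" for i
      using that bnd[of "i + 1"] antimono_from_steps[OF mono(1), of "k + 1" "i + 1"]
      by (simp add: rsvd_diag_def)
  qed (use k dims a0 in \<open>auto simp: rsvd_diag_def diagonal_mat_def\<close>)
  have "?n (B - CUR_approx B P_B S)
      \<le> 1 * (\<eta>_pB * ?n T_Z_hat * ?n (drop_rows k ?I) + \<eta>_s * ?n T_Z22 * ?n ?I)"
    unfolding eta blocks(5-8)
  proof (rule CUR_error_diagonal_factorization[OF qr_Z Z UQ orthogonal_invertible[OF U] _ _ _ _ _ _ _ _
        Bf sel(3,1) blocks(1,3) nonsing(2,4)])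
    show "rsvd_DB m n l \<beta> $$ (i, i) \<noteq> 0" if "i < k" for i
      using that k dims bnd[of "i + 1"] by (simp add: rsvd_DB_def)
    show "\<bar>rsvd_DB m n l \<beta> $$ (i, i)\<bar> \<le> 1" if "k \<le> i" "i < m" "i < l" for i
      using that bnd[of "i + 1"] by (auto simp: rsvd_DB_def)
  qed (use k dims in \<open>auto simp: rsvd_DB_def diagonal_mat_def\<close>)
  also have "\<dots> \<le> \<eta>_pB * ?n T_Z_hat + \<eta>_s * ?n T_Z22"
    using mult_left_mono[OF nI2, of "\<eta>_pB * ?n T_Z_hat"] mult_left_mono[OF nI, of "\<eta>_s * ?n T_Z22"] eta0 n0
    by simp
  finally have B1: "?n (B - CUR_approx B P_B S) \<le> \<eta>_pB * ?n T_Z_hat + \<eta>_s * ?n T_Z22" .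
  have "?n (G - CUR_approx G P S_G)
      \<le> \<gamma> (k + 1) * (\<eta>_p * ?n ?I * ?n T_W22 + \<eta>_sG * ?n (drop_rows k ?I) * ?n T_W_hat)"
    unfolding eta blocks(5-8) dims(1)
  proof (rule CUR_error_diagonal_factorization[OF VQ orthogonal_invertible[OF V] qr_W W _ _ _ _ _ _ _ _
        Gf sel(2,4) blocks(4,2) nonsing(1,3)])
    show "rsvd_diag d n \<gamma> $$ (i, i) \<noteq> 0" if "i < k" for i
      using that k dims bnd[of "i + 1"] by (simp add: rsvd_diag_def)
    show "\<bar>rsvd_diag d n \<gamma> $$ (i, i)\<bar> \<le> \<gamma> (k + 1)" if "k \<le> i" "i < d" "i < n" for i
      using that bnd[of "i + 1"] antimono_from_steps[OF mono(2), of "k + 1" "i + 1"]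
      by (simp add: rsvd_diag_def)
  qed (use k dims c0 in \<open>auto simp: rsvd_diag_def diagonal_mat_def\<close>)
  also have "\<dots> \<le> \<gamma> (k + 1) * (\<eta>_p * ?n T_W22 + \<eta>_sG * ?n T_W_hat)"
  proof (rule mult_left_mono)
    have "\<eta>_p * ?n T_W22 * ?n ?I \<le> \<eta>_p * ?n T_W22" "\<eta>_sG * ?n T_W_hat * ?n (drop_rows k ?I) \<le> \<eta>_sG * ?n T_W_hat"
      using nI nI2 eta0 n0 by (simp_all add: mult_left_le)
    then show "\<eta>_p * ?n ?I * ?n T_W22 + \<eta>_sG * ?n (drop_rows k ?I) * ?n T_W_hat
        \<le> \<eta>_p * ?n T_W22 + \<eta>_sG * ?n T_W_hat"
      by (simp add: mult_ac)
  qed (use c0 in simp)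
  finally have G1: "?n (G - CUR_approx G P S_G)
      \<le> \<gamma> (k + 1) * (\<eta>_p * ?n T_W22 + \<eta>_sG * ?n T_W_hat)" .
  have "\<eta>_p * ?n T_Z_hat * ?n T_W22 + \<eta>_s * ?n T_Z22 * ?n T_W_hat
      \<le> \<eta>_p * ?n T_Z_hat * ?n T_W_hat + \<eta>_s * ?n T_Z_hat * ?n T_W_hat"
    by (intro add_mono mult_mono mult_left_mono Z22 W22) (simp_all add: eta0 n0)
  from mult_left_mono[OF this, of "\<alpha> (k + 1)"] a0
  have A2: "\<alpha> (k + 1) * (\<eta>_p * ?n T_Z_hat * ?n T_W22 + \<eta>_s * ?n T_Z22 * ?n T_W_hat)
      \<le> \<alpha> (k + 1) * (\<eta>_p + \<eta>_s) * ?n T_W_hat * ?n T_Z_hat"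
    by (simp add: algebra_simps)
  have B2: "\<eta>_pB * ?n T_Z_hat + \<eta>_s * ?n T_Z22 \<le> (\<eta>_pB + \<eta>_s) * ?n T_Z_hat"
    using mult_left_mono[OF Z22 eta0(2)] by (simp add: algebra_simps)
  have "\<eta>_p * ?n T_W22 + \<eta>_sG * ?n T_W_hat \<le> (\<eta>_p + \<eta>_sG) * ?n T_W_hat"
    using mult_left_mono[OF W22 eta0(1)] by (simp add: algebra_simps)
  from mult_left_mono[OF this, of "\<gamma> (k + 1)"] c0
  have G2: "\<gamma> (k + 1) * (\<eta>_p * ?n T_W22 + \<eta>_sG * ?n T_W_hat)
      \<le> \<gamma> (k + 1) * (\<eta>_p + \<eta>_sG) * ?n T_W_hat"
    by (simp add: mult.assoc)
  show ?thesis using A1 A2 B1 B2 G1 G2 by blast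
qed

end
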